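(* Let $\sigma_1,\dots,\sigma_k$ be non-crossing partitions and let $q<k$ be an index such that $\sigma_q$ is empty, or connected, or has only singleton blocks. Then \[1[\sigma_1]1[\sigma_2]1\cdots1[\sigma_{q-1}]1[\sigma_q]1[\sigma_{q+1}]1[\sigma_{q+2}]1\cdots1[\sigma_k]1\] is cc-equivalent to \[1[\sigma_1]1[\sigma_2]1\cdots1[\sigma_{q-1}]1[\sigma_{q+1}]1[\sigma_q]1[\sigma_{q+2}]1\cdots1[\sigma_k]1.\]
   Context: Set partitions are written in canonical sequential form (restricted growth words). A partition is non-crossing if it avoids the pattern $1212$ (pattern containment = having a subsequence order-isomorphic to the pattern). Bracket notation: in a word built from letters and bracketed partitions, $[\sigma]$ stands for $\sigma+r$ (add $r$ to every letter), where $r$ is the number of distinct symbols appearing before it; e.g. $1[112]1=12231$ and $\alpha[\beta]$ is $\alpha$ followed by $\beta$ shifted by the number of blocks of $\alpha$. A partition is connected if it cannot be written as $\alpha[\beta]$ with $\alpha,\beta$ nonempty; the components of $\pi$ are the unique nonempty connected $\sigma_i$ with $\pi=\sigma_1[\sigma_2]\cdots[\sigma_m]$. Two non-crossing patterns $\sigma,\tau$ are cc-equivalent if there is a bijection from the set of partitions avoiding both $1212$ and $\sigma$ to the set of partitions avoiding both $1212$ and $\tau$ that preserves size and number of components. *)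

theory Defs
  imports Main "HOL-Library.Sublist"
begin

text \<open>Set partitions of [n] in canonical sequential form: restricted growth words
  over the letters 1,2,... (a word of length n, first letter 1, each letter at most
  one more than the maximum of the preceding letters).\<close>
definition rgw :: "nat list \<Rightarrow> bool" where
  "rgw w \<longleftrightarrow> (\<forall>i<length w. 1 \<le> w ! i \<and> w ! i \<le> Suc (Max (insert 0 (set (take i w)))))"

definition nblocks :: "nat list \<Rightarrow> nat" where
  "nblocks w = card (set w)"

definition order_iso :: "nat list \<Rightarrow> nat list \<Rightarrow> bool" where
  "order_iso xs ys \<longleftrightarrow> length xs = length ys \<and>
     (\<forall>i<length xs. \<forall>j<length xs. (xs ! i < xs ! j \<longleftrightarrow> ys ! i < ys ! j))"

definition contains :: "nat list \<Rightarrow> nat list \<Rightarrow> bool" where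
  "contains w p \<longleftrightarrow> (\<exists>ys. subseq ys w \<and> order_iso ys p)"

definition noncrossing :: "nat list \<Rightarrow> bool" where
  "noncrossing w \<longleftrightarrow> \<not> contains w [1,2,1,2]"

text \<open>Bracket notation: words built from letters and bracketed partitions.
  A bracketed partition [s] is s shifted by the number of distinct symbols before it.\<close>
datatype item = Ltr nat | Brk "nat list"

fun bw :: "nat set \<Rightarrow> item list \<Rightarrow> nat list" where
  "bw S [] = []"
| "bw S (Ltr a # xs) = a # bw (insert a S) xs"
| "bw S (Brk s # xs) = (let t = map (\<lambda>x. x + card S) s in t @ bw (S \<union> set t) xs)"

definition bracket :: "item list \<Rightarrow> nat list" where
  "bracket xs = bw {} xs"

definition bconcat :: "nat list \<Rightarrow> nat list \<Rightarrow> nat list" where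
  "bconcat a b = bracket [Brk a, Brk b]"

definition connected :: "nat list \<Rightarrow> bool" where
  "connected p \<longleftrightarrow> p \<noteq> [] \<and>
     \<not> (\<exists>a b. rgw a \<and> rgw b \<and> a \<noteq> [] \<and> b \<noteq> [] \<and> p = bconcat a b)"

definition is_components :: "nat list \<Rightarrow> nat list list \<Rightarrow> bool" where
  "is_components p cs \<longleftrightarrow> (\<forall>c\<in>set cs. rgw c \<and> connected c) \<and> p = bracket (map Brk cs)"

definition ncomp :: "nat list \<Rightarrow> nat" where
  "ncomp p = (THE m. \<exists>cs. is_components p cs \<and> length cs = m)"

definition av_nc :: "nat list \<Rightarrow> nat list set" where
  "av_nc s = {p. rgw p \<and> noncrossing p \<and> \<not> contains p s}"

definition cc_equiv :: "nat list \<Rightarrow> nat list \<Rightarrow> bool" where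
  "cc_equiv s t \<longleftrightarrow> (\<exists>f. bij_betw f (av_nc s) (av_nc t) \<and>
     (\<forall>p\<in>av_nc s. length (f p) = length p \<and> ncomp (f p) = ncomp p))"

definition onepat :: "nat list list \<Rightarrow> nat list" where
  "onepat ss = bracket (Ltr 1 # concat (map (\<lambda>s. [Brk s, Ltr 1]) ss))"

end

theory Submission
  imports Defs "HOL-Library.Multiset"
begin

text \<open>A connected noncrossing partition is \<open>1[\<pi>\<^sub>1]1\<dots>1[\<pi>\<^sub>m]1\<close>, a list of gaps, each of which is
  again a list of connected noncrossing partitions. Such a component contains
  \<open>\<tau> = 1[\<sigma>\<^sub>1]1\<dots>1[\<sigma>\<^sub>k]1\<close> iff some gap does or the list of gaps can be cut into \<open>k\<close> nonempty
  consecutive pieces, the \<open>j\<close>-th of which contains \<open>\<sigma>\<^sub>j\<close>. Whether a list of gaps contains \<open>\<sigma>\<^sub>q\<close> does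
  not depend on the order of the gaps when \<open>\<sigma>\<^sub>q\<close> is empty, connected or made of singletons. Hence,
  between the shortest prefix that accommodates \<open>\<sigma>\<^sub>1, \<dots>, \<sigma>\<^bsub>q-1\<^esub>\<close> and the shortest suffix that
  accommodates \<open>\<sigma>\<^bsub>q+2\<^esub>, \<dots>, \<sigma>\<^sub>k\<close>, one replaces \<open>A g B\<close> by \<open>B g A\<close>, where \<open>A g\<close> is the shortest
  prefix containing \<open>\<sigma>\<^sub>q\<close>; this exchanges the roles of \<open>\<sigma>\<^sub>q\<close> and \<open>\<sigma>\<^bsub>q+1\<^esub>\<close>.

  Let \<open>\<tau>'\<close> be the other pattern. By induction on the size, the smaller components
  inside the gaps are mapped from \<open>\<tau>\<close>-avoiders to \<open>\<tau>'\<close>-avoiders by a bijection that fixes those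
  avoiding both patterns. A component moved by it contains \<open>\<tau>'\<close>, and its image contains \<open>\<tau>\<close>; hence
  both contain every \<open>\<sigma>\<^sub>j\<close>, so the bijection preserves containment of each \<open>\<sigma>\<^sub>j\<close> in a
  list of gaps.\<close>

section \<open>Restricted growth words\<close>

definition shift :: "nat \<Rightarrow> nat list \<Rightarrow> nat list" where
  "shift r w = map (\<lambda>x. x + r) w"

lemma shift_simps [simp]:
  "shift r [] = []" "shift r (x # w) = (x + r) # shift r w"
  "shift r (u @ v) = shift r u @ shift r v" "shift r (shift s w) = shift (s + r) w"
  "shift 0 w = w" "length (shift r w) = length w" "shift r w = [] \<longleftrightarrow> w = []"
  "set (shift r w) = (\<lambda>x. x + r) ` set w" "nblocks (shift r w) = nblocks w"
  by (auto simp: shift_def nblocks_def card_image add.assoc)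

lemma shift_inject [simp]: "shift r u = shift r v \<longleftrightarrow> u = v"
  unfolding shift_def by (subst inj_map_eq_map) (auto simp: inj_def)

lemma nblocks_Nil [simp]: "nblocks [] = 0"
  by (simp add: nblocks_def)

lemma rgw_Nil [simp]: "rgw []"
  by (simp add: rgw_def)

lemma rgw_snoc_Max:
  "rgw (w @ [x]) \<longleftrightarrow> rgw w \<and> 1 \<le> x \<and> x \<le> Suc (Max (insert 0 (set w)))"
  unfolding rgw_def by (auto simp: nth_append less_Suc_eq)

text \<open>Each letter exceeds the previous maximum by at most one, so no value is skipped. Hence
  \<open>nblocks\<close> is also the maximum, which \<open>rgw_snoc\<close> exploits.\<close>

lemma set_rgw: "rgw w \<Longrightarrow> set w = {1..nblocks w}"
proof (induction w rule: rev_induct)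
  case (snoc x w)
  define n where "n = nblocks w"
  from snoc have x: "1 \<le> x" "x \<le> Suc (Max (insert 0 (set w)))" and w: "set w = {1..n}"
    by (auto simp: rgw_snoc_Max n_def)
  have "Max (insert 0 {1..n}) = n"
    by (rule Max_eqI) auto
  with x w have "x \<le> Suc n" by simp
  hence "insert x {1..n} = {1..n} \<or> insert x {1..n} = {1..Suc n}"
    using x(1) by (cases "x = Suc n") auto
  moreover have "set (w @ [x]) = insert x {1..n}" using w by simp
  ultimately have "\<exists>m. set (w @ [x]) = {1..m}" by metis
  thus ?case by (force simp: nblocks_def)
qed simp

lemma rgw_snoc: "rgw (w @ [x]) \<longleftrightarrow> rgw w \<and> 1 \<le> x \<and> x \<le> Suc (nblocks w)"
proof -
  have "Max (insert 0 {1..n}) = n" for n :: nat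
    by (rule Max_eqI) auto
  thus ?thesis by (auto simp: rgw_snoc_Max dest: set_rgw)
qed

lemma rgw_prefix: "rgw (a @ b) \<Longrightarrow> rgw a"
  by (induction b rule: rev_induct) (auto simp: rgw_snoc simp flip: append_assoc)

lemma rgw_letter_bounds: "rgw w \<Longrightarrow> x \<in> set w \<Longrightarrow> 1 \<le> x \<and> x \<le> nblocks w"
  by (simp add: set_rgw)

lemma nblocks_append_shift:
  assumes "rgw a" "rgw b"
  shows "nblocks (a @ shift (nblocks a) b) = nblocks a + nblocks b"
proof -
  have "set a \<inter> set (shift (nblocks a) b) = {}"
    using assms by (force dest: rgw_letter_bounds)
  thus ?thesis
    using nblocks_def shift_simps(9)[of "nblocks a" b]
    by (simp add: nblocks_def card_Un_disjoint)
qed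

lemma rgw_append_shift:
  assumes "rgw a" "rgw b"
  shows "rgw (a @ shift (nblocks a) b)"
  using assms(2)
proof (induction b rule: rev_induct)
  case (snoc x b)
  hence "rgw b" "1 \<le> x" "x \<le> Suc (nblocks b)"
    by (auto simp: rgw_snoc)
  with snoc.IH show ?case
    using rgw_snoc[of "a @ shift (nblocks a) b" "x + nblocks a"] nblocks_append_shift[OF assms(1)]
    by simp
qed (simp add: assms)

text \<open>Converse of \<open>rgw_append_shift\<close>: a tail made of fresh letters becomes a
  growth word once the shift is undone. Components and gaps are cut out of a word in this
  way.\<close>

lemma rgw_split:
  assumes "rgw (a @ b)" "\<forall>x\<in>set b. nblocks a < x"
  obtains b' where "b = shift (nblocks a) b'" "rgw b'"
proof -
  have "\<exists>b'. b = shift (nblocks a) b' \<and> rgw b'"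
    using assms
  proof (induction b rule: rev_induct)
    case (snoc x b)
    hence x: "nblocks a < x" "x \<le> Suc (nblocks (a @ b))" and ab: "rgw (a @ b)"
      using rgw_snoc[of "a @ b" x] by auto
    from snoc ab obtain b' where b': "b = shift (nblocks a) b'" "rgw b'"
      by auto
    have "nblocks (a @ b) = nblocks a + nblocks b'"
      using nblocks_append_shift[of a b'] rgw_prefix[OF ab] b' by simp
    with x b' have "rgw (b' @ [x - nblocks a])" "b @ [x] = shift (nblocks a) (b' @ [x - nblocks a])"
      by (auto simp: rgw_snoc)
    thus ?case by blast
  qed (auto intro: exI[of _ "[]"])
  thus thesis using that by blast
qed

lemma rgw_hd: "rgw w \<Longrightarrow> w \<noteq> [] \<Longrightarrow> hd w = 1"
  unfolding rgw_def by (cases w) (auto dest!: spec[of _ 0])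

text \<open>The first occurrences of the letters come in increasing order.\<close>

lemma subseq_upt_rgw: "rgw w \<Longrightarrow> subseq [1..<Suc (nblocks w)] w"
proof (induction w rule: rev_induct)
  case (snoc x w)
  hence w: "rgw w" and x: "1 \<le> x" "x \<le> Suc (nblocks w)" and IH: "subseq [1..<Suc (nblocks w)] w"
    by (auto simp: rgw_snoc)
  have S: "set w = {1..nblocks w}" using set_rgw[OF w] .
  show ?case
  proof (cases "x = Suc (nblocks w)")
    case True
    hence "x \<notin> set w" using S by simp
    hence "nblocks (w @ [x]) = Suc (nblocks w)"
      by (simp add: nblocks_def)
    with IH True show ?thesis
      using list_emb_append_mono[OF IH, of "[x]" "[x]"] by simp
  next
    case False
    hence "x \<in> set w" using S x by auto
    hence "nblocks (w @ [x]) = nblocks w"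
      by (simp add: nblocks_def insert_absorb)
    with IH show ?thesis
      using list_emb_append_mono[OF IH, of "[]" "[x]"] by (simp del: upt_Suc)
  qed
qed simp

section \<open>Bracket words\<close>

text \<open>This is \<open>bracket (map Brk cs)\<close> without the set of letters seen so far: the
  tail is built first and then shifted as a whole.\<close>

fun cat_shifted :: "nat list list \<Rightarrow> nat list" where
  "cat_shifted [] = []"
| "cat_shifted (c # cs) = c @ shift (nblocks c) (cat_shifted cs)"

text \<open>\<^term>\<open>gaps_word r gs\<close> is what follows a prefix with \<open>r\<close> blocks that ends in the letter 1,
  so that \<^term>\<open>onepat gs\<close> is \<^term>\<open>1 # gaps_word 1 gs\<close>.\<close>

fun gaps_word :: "nat \<Rightarrow> nat list list \<Rightarrow> nat list" where
  "gaps_word r [] = []"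
| "gaps_word r (g # gs) = shift r g @ 1 # gaps_word (r + nblocks g) gs"

lemma interval_Un_shift:
  assumes "rgw c"
  shows "{1..n} \<union> set (shift n c) = {1..n + nblocks c}"
proof -
  have "(\<lambda>x. x + n) ` {1..nblocks c} = {1 + n..nblocks c + n}"
    by (rule image_add_atLeastAtMost')
  thus ?thesis using set_rgw[OF assms] by auto
qed

text \<open>The set carried along by \<open>bw\<close> remains an initial interval, so only its size
  matters.\<close>

lemma bw_Brk:
  "\<forall>c\<in>set cs. rgw c \<Longrightarrow> bw {1..n} (map Brk cs) = shift n (cat_shifted cs)"
proof (induction cs arbitrary: n)
  case (Cons c cs)
  thus ?case
    using interval_Un_shift[of c n] by (simp add: shift_def[symmetric] Let_def add.commute)
qed simp

lemma bracket_Brk: "\<forall>c\<in>set cs. rgw c \<Longrightarrow> bracket (map Brk cs) = cat_shifted cs"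
  using bw_Brk[of cs 0] by (simp add: bracket_def)

lemma bw_gaps:
  assumes "\<forall>s\<in>set ss. rgw s" "1 \<le> n"
  shows "bw {1..n} (concat (map (\<lambda>s. [Brk s, Ltr 1]) ss)) = gaps_word n ss"
  using assms
proof (induction ss arbitrary: n)
  case (Cons s ss)
  moreover have "insert 1 {1..n + nblocks s} = {1..n + nblocks s}"
    using Cons.prems by auto
  ultimately show ?case
    using interval_Un_shift[of s n] by (simp add: shift_def[symmetric] Let_def)
qed simp

lemma onepat_eq:
  assumes "\<forall>s\<in>set ss. rgw s"
  shows "onepat ss = 1 # gaps_word 1 ss"
  using bw_gaps[OF assms, of 1] by (simp add: onepat_def bracket_def)

lemma rgw_nblocks_cat_shifted:
  "\<forall>c\<in>set cs. rgw c \<Longrightarrow>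
    rgw (cat_shifted cs) \<and> nblocks (cat_shifted cs) = sum_list (map nblocks cs)"
  by (induction cs) (auto simp: rgw_append_shift nblocks_append_shift)

lemma cat_shifted_append:
  "\<forall>c\<in>set as. rgw c \<Longrightarrow>
    cat_shifted (as @ bs) = cat_shifted as @ shift (sum_list (map nblocks as)) (cat_shifted bs)"
  by (induction as) (auto simp: add.commute)

lemma cat_shifted_concat:
  "\<forall>cs\<in>set css. \<forall>c\<in>set cs. rgw c \<Longrightarrow>
    cat_shifted (map cat_shifted css) = cat_shifted (concat css)"
  by (induction css) (auto simp: cat_shifted_append rgw_nblocks_cat_shifted)

text \<open>The prefix \<open>p\<close> is arbitrary because the induction moves the first gap and
  its closing 1 into it. A nonempty \<open>p\<close> already has the letter 1, so that 1 opens no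
  new block.\<close>

lemma rgw_append_gaps_word:
  assumes "rgw p" "p \<noteq> []" "\<forall>g\<in>set gs. rgw g"
  shows "rgw (p @ gaps_word (nblocks p) gs)"
  using assms
proof (induction gs arbitrary: p)
  case (Cons g gs)
  define p' where "p' = p @ shift (nblocks p) g"
  have p': "rgw p'" "nblocks p' = nblocks p + nblocks g" "p' \<noteq> []"
    using Cons.prems by (auto simp: p'_def rgw_append_shift nblocks_append_shift)
  hence "1 \<in> set p'"
    using rgw_hd[of p'] hd_in_set[of p'] by simp
  hence "nblocks (p' @ [1]) = nblocks p'"
    by (simp add: nblocks_def insert_absorb)
  moreover have "rgw (p' @ [1])"
    using p' by (simp add: rgw_snoc)
  ultimately show ?case
    using Cons.IH[of "p' @ [1]"] Cons.prems p' by (simp add: p'_def)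
qed simp

lemma rgw_onepat:
  assumes "\<forall>s\<in>set ss. rgw s"
  shows "rgw (onepat ss)"
proof -
  have "rgw [1]" by (simp add: rgw_def)
  from rgw_append_gaps_word[OF this _ assms] show ?thesis
    by (simp add: onepat_eq[OF assms] nblocks_def)
qed

lemma set_gaps_word:
  assumes "\<forall>g\<in>set gs. rgw g" "x \<in> set (gaps_word r gs)"
  shows "x = 1 \<or> r < x \<and> x \<le> r + sum_list (map nblocks gs)"
  using assms by (induction gs arbitrary: r) (fastforce dest: rgw_letter_bounds)+

lemma gaps_word_append:
  "gaps_word r (as @ bs) = gaps_word r as @ gaps_word (r + sum_list (map nblocks as)) bs"
  by (induction as arbitrary: r) (auto simp: add.assoc)

text \<open>Used for occurrences of a pattern that avoid the letter 1: they live in the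
  concatenation of the gaps.\<close>

lemma filter_gaps_word:
  assumes "\<forall>g\<in>set gs. rgw g" "1 \<le> r"
  shows "filter (\<lambda>x. x \<noteq> 1) (gaps_word r gs) = shift r (cat_shifted gs)"
  using assms
proof (induction gs arbitrary: r)
  case (Cons g gs)
  have "filter (\<lambda>x. x \<noteq> 1) (shift r g) = shift r g"
    using Cons.prems by (auto simp: filter_id_conv dest: rgw_letter_bounds)
  with Cons show ?case by (simp add: add.commute)
qed simp

lemma last_gaps_word:
  assumes "ss \<noteq> []"
  shows "last (gaps_word r ss) = 1" "gaps_word r ss \<noteq> []"
  using assms by (induction ss arbitrary: r) (fastforce split: if_splits)+

section \<open>Pattern containment\<close>

lemma set_subseq: "subseq u w \<Longrightarrow> set u \<subseteq> set w"
  by (auto dest: list_emb_set)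

lemma order_iso_iff_map:
  "order_iso ys p \<longleftrightarrow> (\<exists>f. strict_mono_on (set p) f \<and> ys = map f p)"
proof
  assume iso: "order_iso ys p"
  \<comment> \<open>\<open>SOME\<close> picks one position of \<open>x\<close> in \<open>p\<close>.
    Equal letters of \<open>p\<close> face equal letters of \<open>ys\<close>, so the choice is
    immaterial.\<close>
  define f where "f x = ys ! (SOME i. i < length p \<and> p ! i = x)" for x
  have f: "f (p ! i) = ys ! i" if "i < length p" for i
  proof -
    define j where "j = (SOME j. j < length p \<and> p ! j = p ! i)"
    have "j < length p \<and> p ! j = p ! i"
      unfolding j_def by (rule someI[of _ i]) (simp add: that)
    hence "ys ! j = ys ! i"
      using iso that unfolding order_iso_def by (metis less_irrefl linorder_neqE_nat)
    thus ?thesis by (simp add: f_def j_def)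
  qed
  have "strict_mono_on (set p) f"
    using iso f by (auto simp: order_iso_def in_set_conv_nth intro!: strict_mono_onI)
  moreover have "ys = map f p"
    using iso f by (auto simp: order_iso_def intro: nth_equalityI)
  ultimately show "\<exists>f. strict_mono_on (set p) f \<and> ys = map f p" by blast
next
  assume "\<exists>f. strict_mono_on (set p) f \<and> ys = map f p"
  then obtain f where "strict_mono_on (set p) f" "ys = map f p" by blast
  thus "order_iso ys p"
    by (simp add: order_iso_def strict_mono_on_less)
qed

lemma contains_iff:
  "contains w p \<longleftrightarrow> (\<exists>f. strict_mono_on (set p) f \<and> subseq (map f p) w)"
  by (auto simp: contains_def order_iso_iff_map)

lemma contains_trans:
  assumes "contains w p" "contains p q"
  shows "contains w q"
proof -
  obtain f g where f: "strict_mono_on (set p) f" "subseq (map f p) w"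
    and g: "strict_mono_on (set q) g" "subseq (map g q) p"
    using assms by (auto simp: contains_iff)
  have gq: "g ` set q \<subseteq> set p"
    using set_subseq[OF g(2)] by simp
  have "strict_mono_on (set q) (f \<circ> g)"
    using f(1) g(1) gq unfolding monotone_on_def by (simp add: image_subset_iff)
  moreover have "subseq (map (f \<circ> g) q) w"
    using subseq_map[OF g(2), of f] f(2) subseq_order.trans by fastforce
  ultimately show ?thesis by (auto simp: contains_iff)
qed

lemma contains_subseq: "subseq p w \<Longrightarrow> contains w p"
  by (auto simp: contains_iff intro!: exI[of _ id] strict_mono_onI)

lemma contains_Nil [simp]: "contains w []"
  by (rule contains_subseq) simp

lemma contains_shift: "contains (shift r w) w" and contains_unshift: "contains w (shift r w)"
proof -
  show "contains (shift r w) w"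
    by (auto simp: contains_iff shift_def intro!: exI[of _ "\<lambda>x. x + r"] strict_mono_onI)
  have "map (\<lambda>x. x - r) (shift r w) = w"
    by (simp add: shift_def comp_def)
  \<comment> \<open>Truncated subtraction is strictly increasing here, since all letters of
    \<open>shift r w\<close> are at least \<open>r\<close>.\<close>
  thus "contains w (shift r w)"
    by (auto simp: contains_iff intro!: exI[of _ "\<lambda>x. x - r"] strict_mono_onI)
qed

lemma contains_shift_iff [simp]: "contains (shift r w) p \<longleftrightarrow> contains w p"
  using contains_trans contains_shift contains_unshift by blast

lemma noncrossing_contained: "noncrossing w \<Longrightarrow> contains w u \<Longrightarrow> noncrossing u"
  using contains_trans by (auto simp: noncrossing_def)

lemma subseq_cat_shifted_mem: "c \<in> set cs \<Longrightarrow> \<exists>r. subseq (shift r c) (cat_shifted cs)"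
proof (induction cs)
  case (Cons d cs)
  show ?case
  proof (cases "c = d")
    case True
    thus ?thesis by (auto intro!: exI[of _ 0])
  next
    case False
    with Cons obtain r where "subseq (shift r c) (cat_shifted cs)" by auto
    from subseq_map[OF this, of "\<lambda>x. x + nblocks d"]
    have "subseq (shift (r + nblocks d) c) (shift (nblocks d) (cat_shifted cs))"
      by (metis shift_def shift_simps(4))
    thus ?thesis by (auto intro!: exI[of _ "r + nblocks d"] list_emb_append2)
  qed
qed simp

lemma contains_cat_shifted_mem: "c \<in> set cs \<Longrightarrow> contains c p \<Longrightarrow> contains (cat_shifted cs) p"
  using subseq_cat_shifted_mem contains_subseq contains_shift_iff contains_trans by metis

section \<open>Connected partitions and uniqueness of the components\<close>

lemma bconcat_eq: "rgw a \<Longrightarrow> rgw b \<Longrightarrow> bconcat a b = a @ shift (nblocks a) b"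
  using bracket_Brk[of "[a, b]"] by (simp add: bconcat_def)

text \<open>The largest letter of a nonempty growth word \<open>a\<close> is
  \<open>nblocks a\<close>. The letters of \<open>b\<close> are therefore fresh, and a cut into two
  nonempty parts would be a decomposition by \<open>bconcat\<close>.\<close>

lemma connected_split:
  assumes "rgw (a @ b)" "connected (a @ b)" "\<forall>x\<in>set a. \<forall>y\<in>set b. x < y"
  shows "a = [] \<or> b = []"
proof (rule ccontr)
  assume ne: "\<not> (a = [] \<or> b = [])"
  have a: "rgw a" using assms(1) by (rule rgw_prefix)
  have "nblocks a \<in> set a"
    using set_rgw[OF a] ne by (cases "nblocks a = 0") auto
  hence "\<forall>x\<in>set b. nblocks a < x" using assms(3) by auto
  then obtain b' where b': "b = shift (nblocks a) b'" "rgw b'"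
    using assms(1) rgw_split by blast
  hence "a @ b = bconcat a b'" using a by (simp add: bconcat_eq)
  with assms(2) a b' ne show False unfolding connected_def by auto
qed

text \<open>An occurrence of \<open>p\<close> that reaches beyond the component \<open>c\<close>
  cuts \<open>p\<close> into two parts, the first with smaller letters than the second. By
  connectedness one part is empty.\<close>

lemma contains_cat_shifted_connected:
  assumes "rgw p" "connected p" "\<forall>c\<in>set cs. rgw c"
  shows "contains (cat_shifted cs) p \<longleftrightarrow> (\<exists>c\<in>set cs. contains c p)"
proof
  assume "contains (cat_shifted cs) p"
  thus "\<exists>c\<in>set cs. contains c p"
    using assms(3)
  proof (induction cs)
    case Nil
    thus ?case using assms(2) by (auto simp: contains_iff connected_def)
  next
    case (Cons c cs)
    from Cons.prems(1) obtain f where f: "strict_mono_on (set p) f"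
      and "subseq (map f p) (c @ shift (nblocks c) (cat_shifted cs))"
      by (auto simp: contains_iff)
    then obtain u v where uv: "map f p = u @ v" "subseq u c"
        "subseq v (shift (nblocks c) (cat_shifted cs))"
      by (auto elim: subseq_appendE)
    then obtain a b where ab: "p = a @ b" "u = map f a" "v = map f b"
      by (auto simp: map_eq_append_conv)
    have "x < y" if "x \<in> set a" "y \<in> set b" for x y
    proof -
      have "f x \<in> set c" "f y \<in> set (shift (nblocks c) (cat_shifted cs))"
        using set_subseq[OF uv(2)] set_subseq[OF uv(3)] ab that by auto
      hence "f x \<le> nblocks c" "nblocks c < f y"
        using Cons.prems(2) rgw_nblocks_cat_shifted[of cs] by (auto dest: rgw_letter_bounds)
      thus ?thesis
        using f that ab strict_mono_on_less[OF f, of x y] by auto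
    qed
    hence "a = [] \<or> b = []"
      using connected_split assms(1,2) ab by blast
    thus ?case
    proof
      assume "a = []"
      hence "contains (shift (nblocks c) (cat_shifted cs)) p"
        using uv ab f by (auto simp: contains_iff)
      thus ?thesis using Cons by auto
    next
      assume "b = []"
      thus ?thesis using uv ab f by (auto simp: contains_iff)
    qed
  qed
qed (use contains_cat_shifted_mem in blast)

text \<open>In a decomposition by \<open>bconcat\<close> every letter of the second part, in
  particular the last one, exceeds 1.\<close>

lemma connected_if_last_1:
  assumes "w \<noteq> []" "last w = 1"
  shows "connected w"
  unfolding connected_def
proof (intro conjI notI)
  assume "\<exists>a b. rgw a \<and> rgw b \<and> a \<noteq> [] \<and> b \<noteq> [] \<and> w = bconcat a b"
  then obtain a b where ab: "rgw a" "rgw b" "a \<noteq> []" "b \<noteq> []" "w = a @ shift (nblocks a) b"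
    by (auto simp: bconcat_eq)
  hence "last w \<in> set (shift (nblocks a) b)"
    by (metis last_appendR last_in_set shift_simps(7))
  moreover have "1 \<le> nblocks a"
    using ab by (metis hd_in_set order_trans rgw_letter_bounds)
  ultimately show False
    using assms ab by (auto dest: rgw_letter_bounds)
qed (use assms in simp)

lemma connected_onepat:
  assumes "\<forall>s\<in>set ss. rgw s"
  shows "connected (onepat ss)"
proof (rule connected_if_last_1)
  show "last (onepat ss) = 1"
    using last_gaps_word[of ss 1] onepat_eq[OF assms] by (cases "ss = []") auto
qed (simp add: onepat_eq[OF assms])

text \<open>One of the two first components is a prefix of the other. What the longer one has in
  addition belongs to the shifted rest of the other list, hence has larger letters, and
  connectedness makes it empty.\<close>

lemma cat_shifted_inject:
  assumes "cat_shifted cs = cat_shifted ds"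
    and "\<forall>c\<in>set cs. rgw c \<and> connected c" "\<forall>c\<in>set ds. rgw c \<and> connected c"
  shows "cs = ds"
  using assms
proof (induction cs arbitrary: ds)
  case Nil
  thus ?case by (cases ds) (auto simp: connected_def)
next
  case (Cons c cs)
  have ne: "c \<noteq> []" using Cons.prems by (simp add: connected_def)
  then obtain d ds' where ds: "ds = d # ds'"
    using Cons.prems by (cases ds) auto
  have extend: "z = []"
    if "d = c @ z" "shift (nblocks c) v = z @ y" "rgw d" "connected d" "c \<noteq> []" "rgw v" "rgw c"
    for c d z v y
  proof -
    have "\<forall>x\<in>set c. \<forall>y\<in>set z. x < y"
    proof (intro ballI)
      fix a b assume "a \<in> set c" "b \<in> set z"
      hence "a \<le> nblocks c" "b \<in> set (shift (nblocks c) v)"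
        using that(7) by (auto dest: rgw_letter_bounds simp: that(2) simp del: shift_simps(8))
      thus "a < b" using that(6) by (auto dest: rgw_letter_bounds)
    qed
    thus ?thesis using connected_split that by blast
  qed
  have rg: "rgw (cat_shifted cs)" "rgw (cat_shifted ds')"
    using Cons.prems ds by (auto simp: rgw_nblocks_cat_shifted)
  have "c @ shift (nblocks c) (cat_shifted cs) = d @ shift (nblocks d) (cat_shifted ds')"
    using Cons.prems ds by simp
  then consider z where "d = c @ z" "shift (nblocks c) (cat_shifted cs) = z @ shift (nblocks d) (cat_shifted ds')"
    | z where "c = d @ z" "shift (nblocks d) (cat_shifted ds') = z @ shift (nblocks c) (cat_shifted cs)"
    by (auto simp: append_eq_append_conv2)
  hence "c = d"
  proof cases
    case 1
    have "z = []" by (rule extend[OF 1]) (use Cons.prems(2,3) ds ne rg in auto)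
    thus ?thesis using 1(1) by simp
  next
    case 2
    have "d \<noteq> []" using Cons.prems ds by (simp add: connected_def)
    hence "z = []" by (intro extend[OF 2]) (use Cons.prems(2,3) ds rg in auto)
    thus ?thesis using 2(1) by simp
  qed
  thus ?case using Cons ds by auto
qed

lemma ncomp_cat_shifted:
  assumes "\<forall>c\<in>set cs. rgw c \<and> connected c"
  shows "ncomp (cat_shifted cs) = length cs"
  unfolding ncomp_def
proof (rule the_equality)
  show "\<exists>ds. is_components (cat_shifted cs) ds \<and> length ds = length cs"
    using assms by (auto simp: is_components_def bracket_Brk)
next
  fix m assume "\<exists>ds. is_components (cat_shifted cs) ds \<and> length ds = m"
  thus "m = length cs"
    using assms cat_shifted_inject[of cs] by (auto simp: is_components_def bracket_Brk)
qed

section \<open>Occurrences of a pattern in a component\<close>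

lemma contains_onepat_mem:
  assumes "\<forall>s\<in>set ss. rgw s" "s \<in> set ss"
  shows "contains (onepat ss) s"
proof -
  have "subseq (shift 1 (cat_shifted ss)) (onepat ss)"
    using filter_gaps_word[OF assms(1), of 1] subseq_filter_left[of "\<lambda>x. x \<noteq> 1" "gaps_word 1 ss"]
    by (auto simp: onepat_eq[OF assms(1)])
  hence "contains (onepat ss) (cat_shifted ss)"
    using contains_subseq contains_trans contains_shift by blast
  thus ?thesis
    using contains_cat_shifted_mem[OF assms(2)] contains_trans contains_subseq by blast
qed

text \<open>Every 1 in \<open>gaps_word\<close> closes a gap. The gaps up to the 1 that is matched
  after \<open>u\<close> form \<open>as\<close>, which is therefore nonempty even if
  \<open>u\<close> is empty.\<close>

lemma subseq_gaps_word_split: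
  assumes "\<forall>g\<in>set gs. rgw g" "1 \<le> r" "1 \<notin> set u" "subseq (u @ 1 # v) (gaps_word r gs)"
  shows "\<exists>as bs. gs = as @ bs \<and> as \<noteq> [] \<and> subseq u (shift r (cat_shifted as)) \<and>
    subseq v (gaps_word (r + sum_list (map nblocks as)) bs)"
  using assms
proof (induction gs arbitrary: r u)
  case (Cons g gs)
  have ng: "1 \<notin> set (shift r g)"
    using Cons.prems by (auto dest: rgw_letter_bounds)
  from Cons.prems(4) obtain a b where ab: "u @ 1 # v = a @ b" "subseq a (shift r g)"
      "subseq b (1 # gaps_word (r + nblocks g) gs)"
    by (auto elim: subseq_appendE)
  have "1 \<notin> set a" using set_subseq[OF ab(2)] ng by auto
  with ab(1) obtain u' where u': "u = a @ u'" "b = u' @ 1 # v"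
    by (auto simp: append_eq_append_conv2 append_eq_Cons_conv Cons_eq_append_conv)
  show ?case
  proof (cases u')
    case Nil
    hence "subseq u (shift r (cat_shifted [g]))" "subseq v (gaps_word (r + nblocks g) gs)"
      using u' ab by auto
    thus ?thesis by (intro exI[of _ "[g]"] exI[of _ gs]) simp
  next
    case (Cons x u'')
    hence "x \<noteq> 1" using Cons.prems u' by auto
    hence "subseq (u' @ 1 # v) (gaps_word (r + nblocks g) gs)"
      using ab(3) u' Cons by (auto simp: subseq_Cons2_neq)
    then obtain as bs where *: "gs = as @ bs" "subseq u' (shift (r + nblocks g) (cat_shifted as))"
        "subseq v (gaps_word (r + nblocks g + sum_list (map nblocks as)) bs)"
      using Cons.IH[of "r + nblocks g" u'] Cons.prems u' by auto
    have "subseq u (shift r (cat_shifted (g # as)))"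
      using list_emb_append_mono[OF ab(2) *(2)] u' by (simp add: add.commute)
    thus ?thesis
      using * by (intro exI[of _ "g # as"] exI[of _ bs]) (simp add: add.assoc)
  qed
qed simp

definition chain :: "('a list \<Rightarrow> bool) \<Rightarrow> ('a list \<Rightarrow> bool) \<Rightarrow> 'a list \<Rightarrow> bool" where
  "chain P Q xs \<longleftrightarrow> (\<exists>as bs. xs = as @ bs \<and> P as \<and> Q bs)"

text \<open>A bracketed block of a pattern lies between two occurrences of 1, so even an empty block
  uses up at least one gap.\<close>

definition gaps_contain :: "nat list \<Rightarrow> nat list list \<Rightarrow> bool" where
  "gaps_contain s gs \<longleftrightarrow> gs \<noteq> [] \<and> contains (cat_shifted gs) s"

text \<open>The base case accepts every list, so gaps may be left over after the last block.\<close>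

definition splits :: "('b \<Rightarrow> 'a list \<Rightarrow> bool) \<Rightarrow> 'b list \<Rightarrow> 'a list \<Rightarrow> bool" where
  "splits P ss = foldr (\<lambda>s. chain (P s)) ss (\<lambda>_. True)"

lemma splits_simps [simp]:
  "splits P [] = (\<lambda>_. True)"
  "splits P (s # ss) = chain (P s) (splits P ss)"
  by (simp_all add: splits_def)

text \<open>As \<open>f\<close> fixes 1, each 1 of the pattern lands on a 1 that closes a gap, and
  each block, whose letters are mapped above 1, lies in the gaps between two such places.\<close>

lemma gaps_split_if_subseq:
  assumes "\<forall>s\<in>set ss. rgw s" "\<forall>g\<in>set gs. rgw g" "1 \<le> r" "1 \<le> r'"
    and "f 1 = 1" "strict_mono_on (insert 1 (set (gaps_word r ss))) f"
    and "subseq (map f (gaps_word r ss)) (gaps_word r' gs)"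
  shows "splits gaps_contain ss gs"
  using assms
proof (induction ss arbitrary: gs r r')
  case (Cons s ss)
  let ?u = "map f (shift r s)"
  have mono: "strict_mono_on (set (shift r s)) f"
    using Cons.prems(6) by (rule monotone_on_subset) auto
  have "1 \<notin> set ?u"
  proof
    assume "1 \<in> set ?u"
    then obtain x where x: "x \<in> set (shift r s)" "f x = 1" by (metis imageE set_map)
    hence "1 < x" using Cons.prems by (auto dest: rgw_letter_bounds)
    hence "f 1 < f x" by (intro strict_mono_onD[OF Cons.prems(6)]) (use x in auto)
    thus False using x Cons.prems by simp
  qed
  moreover have "subseq (?u @ 1 # map f (gaps_word (r + nblocks s) ss)) (gaps_word r' gs)"
    using Cons.prems by simp
  ultimately obtain as bs where *: "gs = as @ bs" "as \<noteq> []" "subseq ?u (shift r' (cat_shifted as))"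
      "subseq (map f (gaps_word (r + nblocks s) ss)) (gaps_word (r' + sum_list (map nblocks as)) bs)"
    using subseq_gaps_word_split[of gs r'] Cons.prems by blast
  have "contains (cat_shifted as) (shift r s)"
    using *(3) mono contains_shift_iff contains_iff by blast
  hence "contains (cat_shifted as) s"
    using contains_trans contains_shift by blast
  moreover have "splits gaps_contain ss bs"
  proof (rule Cons.IH)
    show "strict_mono_on (insert 1 (set (gaps_word (r + nblocks s) ss))) f"
      using Cons.prems(6) by (rule monotone_on_subset) auto
  qed (use *(1,4) Cons.prems in auto)
  ultimately show ?case
    using * unfolding splits_simps chain_def gaps_contain_def[of s] by blast
qed simp

text \<open>All occurrences of 1 but the last one are dropped.\<close>

lemma subseq_gaps_word:
  "as \<noteq> [] \<Longrightarrow> subseq (shift r (cat_shifted as) @ [1]) (gaps_word r as)"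
proof (induction as arbitrary: r)
  case (Cons a as)
  show ?case
  proof (cases "as = []")
    case False
    hence "subseq (shift (r + nblocks a) (cat_shifted as) @ [1]) (1 # gaps_word (r + nblocks a) as)"
      using Cons.IH by blast
    from list_emb_append_mono[OF subseq_order.refl[of "shift r a"] this] show ?thesis
      by (simp add: add.commute)
  qed simp
qed simp

text \<open>The relabelling is glued from relabellings of the single blocks. The lower bound
  \<open>r'\<close> on its values is carried through the induction so that later blocks get larger
  letters; the letter 1 is treated separately by \<open>f(1 := 1)\<close>.\<close>

lemma subseq_if_gaps_split:
  assumes "\<forall>s\<in>set ss. rgw s" "\<forall>g\<in>set gs. rgw g" "1 \<le> r" "1 \<le> r'" "splits gaps_contain ss gs"
  shows "\<exists>f. strict_mono_on {r<..r + sum_list (map nblocks ss)} f \<and>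
    (\<forall>x\<in>{r<..r + sum_list (map nblocks ss)}. r' < f x) \<and>
    subseq (map (f(1 := 1)) (gaps_word r ss)) (gaps_word r' gs)"
  using assms
proof (induction ss arbitrary: gs r r')
  case Nil
  show ?case by (auto intro!: exI[of _ id] strict_mono_onI)
next
  case (Cons s ss)
  from Cons.prems obtain as bs where gs: "gs = as @ bs" "as \<noteq> []" "contains (cat_shifted as) s"
      "splits gaps_contain ss bs"
    unfolding splits_simps chain_def gaps_contain_def[of s] by blast
  then obtain e where e: "strict_mono_on (set s) e" "subseq (map e s) (cat_shifted as)"
    by (auto simp: contains_iff)
  define m where "m = nblocks s"
  define M where "M = sum_list (map nblocks as)"
  have s: "set s = {1..m}" using Cons.prems set_rgw m_def by auto
  have "\<forall>x\<in>set (cat_shifted as). 1 \<le> x \<and> x \<le> M"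
    using rgw_nblocks_cat_shifted[of as] rgw_letter_bounds[of "cat_shifted as"] Cons.prems(2) gs(1)
    by (auto simp: M_def)
  hence ebound: "1 \<le> e x \<and> e x \<le> M" if "x \<in> {1..m}" for x
    using set_subseq[OF e(2)] that s by (simp add: image_subset_iff)
  have "\<exists>f. strict_mono_on {r + m<..r + m + sum_list (map nblocks ss)} f \<and>
      (\<forall>x\<in>{r + m<..r + m + sum_list (map nblocks ss)}. r' + M < f x) \<and>
      subseq (map (f(1 := 1)) (gaps_word (r + m) ss)) (gaps_word (r' + M) bs)"
    by (rule Cons.IH) (use Cons.prems gs in auto)
  then obtain f where f: "strict_mono_on {r + m<..r + m + sum_list (map nblocks ss)} f"
      "\<forall>x\<in>{r + m<..r + m + sum_list (map nblocks ss)}. r' + M < f x"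
      "subseq (map (f(1 := 1)) (gaps_word (r + m) ss)) (gaps_word (r' + M) bs)"
    by blast
  \<comment> \<open>Letters up to \<open>r + m\<close> belong to the block \<open>s\<close> and are
    sent by \<open>e\<close> into the letters of \<open>as\<close>; the later ones follow
    \<open>f\<close>, whose values exceed \<open>r' + M\<close>.\<close>
  define h where "h x = (if x \<le> r + m then e (x - r) + r' else f x)" for x
  have low: "r' < h x \<and> h x \<le> r' + M" if "r < x" "x \<le> r + m" for x
  proof -
    have "x - r \<in> {1..m}" using that by auto
    from ebound[OF this] that show ?thesis by (simp add: h_def)
  qed
  have "strict_mono_on {r<..r + (m + sum_list (map nblocks ss))} h"
  proof (rule strict_mono_onI)
    fix x y assume xy: "x \<in> {r<..r + (m + sum_list (map nblocks ss))}"
      "y \<in> {r<..r + (m + sum_list (map nblocks ss))}" "x < y"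
    consider "y \<le> r + m" | "x \<le> r + m" "r + m < y" | "r + m < x" by linarith
    thus "h x < h y"
    proof cases
      case 1
      thus ?thesis using xy strict_mono_onD[OF e(1), of "x - r" "y - r"] s by (auto simp: h_def)
    next
      case 2
      thus ?thesis using xy low[of x] f(2) by (force simp: h_def)
    next
      case 3
      thus ?thesis using xy strict_mono_onD[OF f(1), of x y] by (auto simp: h_def)
    qed
  qed
  moreover have "\<forall>x\<in>{r<..r + (m + sum_list (map nblocks ss))}. r' < h x"
  proof
    fix x assume x: "x \<in> {r<..r + (m + sum_list (map nblocks ss))}"
    show "r' < h x"
    proof (cases "x \<le> r + m")
      case False
      hence "r' + M < f x" using x f(2) by auto
      thus ?thesis using False by (simp add: h_def)
    qed (use low x in auto)
  qed
  moreover have "subseq (map (h(1 := 1)) (gaps_word r (s # ss))) (gaps_word r' gs)"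
  proof -
    have 1: "map (h(1 := 1)) (shift r s) = shift r' (map e s)"
      using s Cons.prems(3) by (auto simp: shift_def h_def)
    have 2: "map (h(1 := 1)) (gaps_word (r + m) ss) = map (f(1 := 1)) (gaps_word (r + m) ss)"
      using Cons.prems by (auto simp: h_def dest!: set_gaps_word[rotated])
    have "subseq (shift r' (map e s) @ [1]) (shift r' (cat_shifted as) @ [1])"
      using subseq_map[OF e(2), of "\<lambda>x. x + r'"] by (simp add: shift_def)
    hence "subseq (shift r' (map e s) @ [1]) (gaps_word r' as)"
      using subseq_gaps_word[OF gs(2)] subseq_order.trans by blast
    from list_emb_append_mono[OF this f(3)] show ?thesis
      using 1 2 by (simp add: gs gaps_word_append M_def m_def del: map_eq_conv)
  qed
  ultimately show ?case unfolding m_def list.map sum_list.Cons by blast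
qed

text \<open>The two alternatives are told apart by the image of the letter 1. If it is 1, the
  occurrence cuts the list of gaps. Otherwise no letter is mapped to 1, so the occurrence lies in
  the concatenated gaps and, the pattern being connected, in a single gap.\<close>

lemma contains_onepat_iff:
  assumes ss: "\<forall>s\<in>set ss. rgw s" and gs: "\<forall>g\<in>set gs. rgw g"
  shows "contains (onepat gs) (onepat ss) \<longleftrightarrow>
    (\<exists>g\<in>set gs. contains g (onepat ss)) \<or> splits gaps_contain ss gs"
proof
  assume "contains (onepat gs) (onepat ss)"
  then obtain f where f: "strict_mono_on (set (onepat ss)) f" "subseq (map f (onepat ss)) (onepat gs)"
    by (auto simp: contains_iff)
  have 1: "1 \<in> set (onepat ss)" by (simp add: onepat_eq[OF ss])
  hence "f 1 \<in> set (onepat gs)" using set_subseq[OF f(2)] by auto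
  hence f1: "1 \<le> f 1" using rgw_letter_bounds rgw_onepat[OF gs] by blast
  show "(\<exists>g\<in>set gs. contains g (onepat ss)) \<or> splits gaps_contain ss gs"
  proof (cases "f 1 = 1")
    case True
    have "splits gaps_contain ss gs"
    proof (rule gaps_split_if_subseq[where f = f and r = 1 and r' = 1])
      show "strict_mono_on (insert 1 (set (gaps_word 1 ss))) f"
        using f(1) by (simp add: onepat_eq[OF ss])
      show "subseq (map f (gaps_word 1 ss)) (gaps_word 1 gs)"
        using f(2) True by (simp add: onepat_eq ss gs)
    qed (use ss gs True in auto)
    thus ?thesis ..
  next
    case False
    have "f x \<noteq> 1" if "x \<in> set (onepat ss)" for x
    proof -
      have "1 \<le> x" using that rgw_letter_bounds rgw_onepat[OF ss] by blast
      hence "f 1 \<le> f x"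
        using strict_mono_on_leD[OF f(1) 1 that] by blast
      thus ?thesis using False f1 by linarith
    qed
    hence "filter (\<lambda>x. x \<noteq> 1) (map f (onepat ss)) = map f (onepat ss)"
      by (auto simp: filter_id_conv)
    with subseq_filter[OF f(2), of "\<lambda>x. x \<noteq> 1"]
    have "subseq (map f (onepat ss)) (shift 1 (cat_shifted gs))"
      using filter_gaps_word[OF gs, of 1] by (simp add: onepat_eq[OF gs])
    hence "contains (cat_shifted gs) (onepat ss)"
      using f(1) contains_shift_iff contains_iff by blast
    thus ?thesis
      using contains_cat_shifted_connected[OF rgw_onepat connected_onepat] ss gs by blast
  qed
next
  assume "(\<exists>g\<in>set gs. contains g (onepat ss)) \<or> splits gaps_contain ss gs"
  thus "contains (onepat gs) (onepat ss)"
  proof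
    assume "\<exists>g\<in>set gs. contains g (onepat ss)"
    thus ?thesis using contains_onepat_mem[OF gs] contains_trans by blast
  next
    assume "splits gaps_contain ss gs"
    from subseq_if_gaps_split[OF ss gs _ _ this, of 1 1] obtain f where
      f: "strict_mono_on {1<..1 + sum_list (map nblocks ss)} f"
        "\<forall>x\<in>{1<..1 + sum_list (map nblocks ss)}. 1 < f x"
        "subseq (map (f(1 := 1)) (gaps_word 1 ss)) (gaps_word 1 gs)"
      by auto
    have "set (onepat ss) \<subseteq> insert 1 {1<..1 + sum_list (map nblocks ss)}"
      using set_gaps_word[OF ss, of _ 1] by (force simp: onepat_eq[OF ss])
    moreover have "strict_mono_on (insert 1 {1<..1 + sum_list (map nblocks ss)}) (f(1 := 1))"
      using f(1,2) unfolding monotone_on_def by auto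
    ultimately have "strict_mono_on (set (onepat ss)) (f(1 := 1))"
      using monotone_on_subset by blast
    moreover have "subseq (map (f(1 := 1)) (onepat ss)) (onepat gs)"
      using f(3) by (simp add: onepat_eq ss gs)
    ultimately show ?thesis unfolding contains_iff by blast
  qed
qed

section \<open>Noncrossing partitions as trees\<close>

lemma rgw_1212: "rgw [1, 2, 1, 2]"
  using rgw_snoc[of "[1,2,1]" 2] rgw_snoc[of "[1,2]" 1] rgw_snoc[of "[1]" 2] rgw_snoc[of "[]" 1]
  by (simp add: nblocks_def insert_commute)

text \<open>Connectedness reduces crossings in a concatenation to crossings inside one component, by
  \<open>contains_cat_shifted_connected\<close>.\<close>

lemma connected_1212: "connected [1, 2, 1, 2]"
  unfolding connected_def
proof (intro conjI notI)
  assume "\<exists>a b. rgw a \<and> rgw b \<and> a \<noteq> [] \<and> b \<noteq> [] \<and> [1, 2, 1, 2] = bconcat a b"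
  then obtain a b where ab: "rgw a" "rgw b" "a \<noteq> []" "b \<noteq> []"
      "[1, 2, 1, 2] = a @ shift (nblocks a) b"
    by (auto simp: bconcat_eq)
  moreover have "\<forall>x\<in>set (shift (nblocks a) b). nblocks a < x"
    using ab(2) by (auto dest: rgw_letter_bounds)
  ultimately obtain v where "[1, 2, 1, 2] = a @ v" "v \<noteq> []" "\<forall>x\<in>set v. nblocks a < x"
    by (metis shift_simps(7))
  with ab(3) show False
    by (auto simp: Cons_eq_append_conv nblocks_def insert_commute)
qed simp

lemma noncrossing_cat_shifted:
  assumes "\<forall>c\<in>set cs. rgw c \<and> noncrossing c"
  shows "noncrossing (cat_shifted cs)"
  using assms contains_cat_shifted_connected[OF rgw_1212 connected_1212, of cs]
  by (auto simp: noncrossing_def)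

lemma noncrossing_iff: "noncrossing w \<longleftrightarrow> (\<forall>x y. x < y \<longrightarrow> \<not> subseq [x, y, x, y] w)"
proof
  assume nc: "noncrossing w"
  show "\<forall>x y. x < y \<longrightarrow> \<not> subseq [x, y, x, y] w"
  proof (intro allI impI notI)
    fix x y :: nat assume xy: "x < y" "subseq [x, y, x, y] w"
    have "contains w [1, 2, 1, 2]"
      unfolding contains_iff using xy
      by (intro exI[of _ "\<lambda>i. if i = 1 then x else y"]) (auto intro!: strict_mono_onI)
    thus False using nc by (simp add: noncrossing_def)
  qed
next
  assume *: "\<forall>x y. x < y \<longrightarrow> \<not> subseq [x, y, x, y] w"
  show "noncrossing w"
    unfolding noncrossing_def contains_iff
  proof
    assume "\<exists>f. strict_mono_on (set [1, 2, 1, 2 :: nat]) f \<and> subseq (map f [1, 2, 1, 2]) w"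
    then obtain f :: "nat \<Rightarrow> nat" where "strict_mono_on {1, 2} f" "subseq [f 1, f 2, f 1, f 2] w"
      by (auto simp: insert_commute)
    thus False using * strict_mono_onD[of "{1, 2}" f 1 2] by auto
  qed
qed

text \<open>A crossing that involves 1 needs a letter \<open>y\<close> on both sides of a 1, but
  different gaps have disjoint letters. Any other crossing lies in the concatenation of the
  gaps.\<close>

lemma noncrossing_onepat:
  assumes "\<forall>g\<in>set gs. rgw g \<and> noncrossing g"
  shows "noncrossing (onepat gs)"
  unfolding noncrossing_iff
proof (intro allI impI notI)
  fix x y :: nat assume xy: "x < y" "subseq [x, y, x, y] (onepat gs)"
  have gs: "\<forall>g\<in>set gs. rgw g" using assms by blast
  have "x \<in> set (onepat gs)" using set_subseq[OF xy(2)] by auto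
  hence "1 \<le> x" using rgw_letter_bounds rgw_onepat[OF gs] by blast
  show False
  proof (cases "x = 1")
    case True
    hence "subseq ([y] @ 1 # [y]) (gaps_word 1 gs)"
      using xy by (simp add: onepat_eq[OF gs])
    then obtain as bs where *: "gs = as @ bs" "subseq [y] (shift 1 (cat_shifted as))"
        "subseq [y] (gaps_word (1 + sum_list (map nblocks as)) bs)"
      using subseq_gaps_word_split[OF gs, of 1 "[y]" "[y]"] xy True by auto
    have "y \<in> set (shift 1 (cat_shifted as))" using set_subseq[OF *(2)] by simp
    hence "y \<le> 1 + sum_list (map nblocks as)"
      using rgw_nblocks_cat_shifted[of as] gs * by (auto dest: rgw_letter_bounds)
    moreover have "y \<in> set (gaps_word (1 + sum_list (map nblocks as)) bs)"
      using set_subseq[OF *(3)] by simp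
    hence "1 + sum_list (map nblocks as) < y"
      using set_gaps_word[of bs y] gs * xy True by auto
    ultimately show False by simp
  next
    case False
    with xy \<open>1 \<le> x\<close> have "filter (\<lambda>x. x \<noteq> 1) [x, y, x, y] = [x, y, x, y]" by simp
    with subseq_filter[OF xy(2), of "\<lambda>x. x \<noteq> 1"]
    have "subseq [x, y, x, y] (shift 1 (cat_shifted gs))"
      using filter_gaps_word[OF gs, of 1] by (simp add: onepat_eq[OF gs])
    moreover have "noncrossing (shift 1 (cat_shifted gs))"
      using noncrossing_cat_shifted[OF assms] by (simp add: noncrossing_def)
    ultimately show False using xy(1) by (simp add: noncrossing_iff)
  qed
qed

text \<open>A tree is a connected noncrossing partition, given by the list of its gaps between
  consecutive occurrences of 1; a gap is the list of its components.\<close>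

datatype tree = Node "tree list list"

primrec tree_word :: "tree \<Rightarrow> nat list" where
  "tree_word (Node gs) = onepat (map cat_shifted (map (map tree_word) gs))"

definition forest_word :: "tree list \<Rightarrow> nat list" where
  "forest_word ts = cat_shifted (map tree_word ts)"

lemma tree_word_Node: "tree_word (Node gs) = onepat (map forest_word gs)"
  by (simp add: forest_word_def[abs_def] comp_def)

declare tree_word.simps [simp del]

lemma rgw_noncrossing_tree_word: "rgw (tree_word t) \<and> noncrossing (tree_word t)"
proof (induction t)
  case (Node gs)
  hence "\<forall>w\<in>set (map forest_word gs). rgw w \<and> noncrossing w"
    by (auto simp: forest_word_def rgw_nblocks_cat_shifted noncrossing_cat_shifted)
  thus ?case by (simp add: tree_word_Node rgw_onepat noncrossing_onepat)
qed

lemma rgw_tree_word [simp]: "rgw (tree_word t)"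
  using rgw_noncrossing_tree_word by blast

lemma rgw_forest_word [simp]: "rgw (forest_word ts)"
  by (simp add: forest_word_def rgw_nblocks_cat_shifted)

lemma noncrossing_forest_word: "noncrossing (forest_word ts)"
  by (simp add: forest_word_def noncrossing_cat_shifted rgw_noncrossing_tree_word)

lemma connected_tree_word: "connected (tree_word t)"
  by (cases t) (simp add: tree_word_Node connected_onepat)

lemma ncomp_forest_word: "ncomp (forest_word ts) = length ts"
  by (simp add: forest_word_def ncomp_cat_shifted connected_tree_word)

lemma length_gaps_word: "length (gaps_word r gs) = length gs + sum_list (map length gs)"
  by (induction gs arbitrary: r) auto

lemma length_cat_shifted: "length (cat_shifted cs) = sum_list (map length cs)"
  by (induction cs) auto

lemma length_forest_word: "length (forest_word ts) = sum_list (map (length \<circ> tree_word) ts)"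
  by (simp add: forest_word_def length_cat_shifted)

lemma length_tree_word_Node:
  "length (tree_word (Node gs)) = Suc (length gs + sum_list (map (length \<circ> forest_word) gs))"
  by (simp add: tree_word_Node onepat_eq length_gaps_word)

text \<open>The shifted gaps are free of 1, so the first 1 marks the end of the first gap.\<close>

lemma gaps_word_inject:
  assumes "gaps_word r gs = gaps_word r hs" "\<forall>g\<in>set gs. rgw g" "\<forall>h\<in>set hs. rgw h" "1 \<le> r"
  shows "gs = hs"
  using assms
proof (induction gs arbitrary: r hs)
  case Nil
  thus ?case by (cases hs) auto
next
  case (Cons g gs)
  then obtain h hs' where hs: "hs = h # hs'" by (cases hs) auto
  have split: "a = b \<and> x = y" if "a @ 1 # x = b @ 1 # y" "1 \<notin> set a" "1 \<notin> set b"
    for a b x y :: "nat list"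
    using that by (auto simp: append_eq_append_conv2 append_eq_Cons_conv Cons_eq_append_conv)
  have "1 \<notin> set (shift r g)" "1 \<notin> set (shift r h)"
    using Cons.prems hs by (auto dest: rgw_letter_bounds)
  from split[OF _ this] have
    "shift r g = shift r h \<and> gaps_word (r + nblocks g) gs = gaps_word (r + nblocks h) hs'"
    using Cons.prems hs by simp
  thus ?case using Cons.IH[of "r + nblocks g" hs'] Cons.prems hs by simp
qed

lemma map_tree_word_inject:
  "map tree_word ts = map tree_word us" if "forest_word ts = forest_word us"
  by (rule cat_shifted_inject) (use that in \<open>auto simp: forest_word_def connected_tree_word\<close>)

lemma inj_tree_word: "inj tree_word"
proof (rule injI)
  fix t u show "tree_word t = tree_word u \<Longrightarrow> t = u"
  proof (induction t arbitrary: u)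
    case (Node gs)
    obtain hs where u: "u = Node hs" by (cases u)
    have "map forest_word gs = map forest_word hs"
      using Node.prems gaps_word_inject[of 1 "map forest_word gs" "map forest_word hs"]
      by (auto simp: u tree_word_Node onepat_eq)
    hence len: "length gs = length hs"
      and gh: "\<And>i. i < length gs \<Longrightarrow> forest_word (gs ! i) = forest_word (hs ! i)"
      by (auto simp: list_eq_iff_nth_eq)
    have "gs ! i = hs ! i" if i: "i < length gs" for i
    proof -
      have "map tree_word (gs ! i) = map tree_word (hs ! i)"
        using gh[OF i] by (rule map_tree_word_inject)
      hence "length (gs ! i) = length (hs ! i)"
        and "\<And>j. j < length (gs ! i) \<Longrightarrow> tree_word (gs ! i ! j) = tree_word (hs ! i ! j)"
        by (auto simp: list_eq_iff_nth_eq)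
      thus ?thesis using Node.IH[OF nth_mem[OF i] nth_mem] by (auto intro!: nth_equalityI)
    qed
    thus ?case using len u by (auto intro: nth_equalityI)
  qed
qed

lemma inj_forest_word: "inj forest_word"
  using map_tree_word_inject inj_tree_word by (auto intro!: injI)

section \<open>Every noncrossing partition is the word of a forest\<close>

text \<open>An old letter \<open>x\<close> in \<open>v\<close> would occur in \<open>p\<close>
  between its first and its last letter, both equal to 1, and complete the crossing
  \<open>1 x 1 x\<close>.\<close>

lemma fresh_letters:
  assumes "rgw (p @ v)" "noncrossing (p @ v)" "p \<noteq> []" "last p = 1" "1 \<notin> set v"
  shows "\<forall>x\<in>set v. nblocks p < x"
proof (rule ballI, rule ccontr)
  fix x assume x: "x \<in> set v" "\<not> nblocks p < x"
  have p: "rgw p" using assms(1) by (rule rgw_prefix)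
  have "1 \<le> x" using x rgw_letter_bounds[OF assms(1)] by simp
  hence xp: "x \<in> set p" "x \<noteq> 1"
    using set_rgw[OF p] x assms(5) by auto
  obtain p' where p': "p = 1 # p'" using rgw_hd[OF p] assms(3) by (cases p) auto
  hence "p' \<noteq> []" using xp by auto
  then obtain p'' where p'': "p = 1 # p'' @ [1]"
    using p' assms(4) by (metis append_butlast_last_id last_ConsR)
  hence "subseq [x] p''" "subseq [x] v"
    using xp x by (auto simp: subseq_singleton_left)
  hence "subseq ([x] @ [1] @ [x]) (p'' @ [1] @ v)"
    by (intro list_emb_append_mono) auto
  hence "subseq [1, x, 1, x] (p @ v)" using p'' by simp
  thus False using assms(2) xp \<open>1 \<le> x\<close> unfolding noncrossing_iff by (metis nat_less_le)
qed

text \<open>The letters before the next 1 are fresh and form a gap. Gap and closing 1 are then moved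
  into the prefix, which thus keeps ending in 1.\<close>

lemma gaps_word_exists:
  assumes "rgw (p @ y)" "noncrossing (p @ y)" "p \<noteq> []" "last p = 1" "y = [] \<or> last y = 1"
  shows "\<exists>gs. y = gaps_word (nblocks p) gs \<and> (\<forall>g\<in>set gs. rgw g)"
  using assms
proof (induction "length y" arbitrary: p y rule: less_induct)
  case less
  show ?case
  proof (cases "y = []")
    case True
    thus ?thesis by (intro exI[of _ "[]"]) simp
  next
    case False
    hence "1 \<in> set y" using less.prems(5) last_in_set by fastforce
    then obtain x z where y: "y = x @ 1 # z" "1 \<notin> set x" by (metis split_list_first)
    have px: "rgw (p @ x)" using less.prems(1) y rgw_prefix[of "p @ x"] by simp
    have "noncrossing (p @ x)"
      using less.prems(2) by (rule noncrossing_contained) (auto simp: y intro!: contains_subseq)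
    then obtain g where g: "x = shift (nblocks p) g" "rgw g"
      using rgw_split[OF px] fresh_letters[OF px] less.prems(3,4) y(2) by blast
    have p: "rgw p" using px by (rule rgw_prefix)
    have "1 \<in> set p" using less.prems(3,4) last_in_set by fastforce
    hence "nblocks (p @ x @ [1]) = nblocks (p @ x)"
      by (simp add: nblocks_def insert_absorb)
    also have "\<dots> = nblocks p + nblocks g"
      using nblocks_append_shift[OF p g(2)] g(1) by simp
    finally have nb: "nblocks (p @ x @ [1]) = nblocks p + nblocks g" .
    have "\<exists>gs. z = gaps_word (nblocks (p @ x @ [1])) gs \<and> (\<forall>g\<in>set gs. rgw g)"
      by (rule less.hyps) (use less.prems y in \<open>auto split: if_splits\<close>)
    then obtain gs where "z = gaps_word (nblocks p + nblocks g) gs" "\<forall>g\<in>set gs. rgw g"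
      using nb by auto
    thus ?thesis using y g by (intro exI[of _ "g # gs"]) auto
  qed
qed

text \<open>The prefix up to the last 1 is the first component, because all letters after it are
  fresh. Its gaps and the remaining word are shorter noncrossing partitions.\<close>

lemma forest_word_exists: "rgw w \<Longrightarrow> noncrossing w \<Longrightarrow> \<exists>ts. forest_word ts = w"
proof (induction "length w" arbitrary: w rule: less_induct)
  case less
  show ?case
  proof (cases "w = []")
    case True
    thus ?thesis by (intro exI[of _ "[]"]) (simp add: forest_word_def)
  next
    case False
    hence "1 \<in> set w" using less.prems(1) rgw_hd hd_in_set by fastforce
    then obtain u v where uv: "w = u @ 1 # v" "1 \<notin> set v" by (metis split_list_last)
    define c where "c = u @ [1]"
    have w: "w = c @ v" "c \<noteq> []" "last c = 1" using uv by (auto simp: c_def)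
    have c: "rgw c" "noncrossing c"
      using less.prems rgw_prefix[of c v] w(1)
        noncrossing_contained[of w c] contains_subseq[of c w] by auto
    obtain v' where v': "v = shift (nblocks c) v'" "rgw v'"
      using rgw_split[of c v] fresh_letters[of c v] less.prems w uv(2) by blast
    have "noncrossing v"
      using less.prems(2) by (rule noncrossing_contained) (auto simp: w intro!: contains_subseq)
    hence "noncrossing v'" using v'(1) by (simp add: noncrossing_def)
    then obtain ts where ts: "forest_word ts = v'"
      using less.hyps[of v'] v' w by (metis length_append length_greater_0_conv less_add_same_cancel2 shift_simps(6))
    obtain c' where c': "c = [1] @ c'" using rgw_hd[OF c(1) w(2)] w(2) by (cases c) auto
    hence "c' = [] \<or> last c' = 1" using w(3) by (cases "c' = []") auto
    then obtain gs where gs: "c' = gaps_word 1 gs" "\<forall>g\<in>set gs. rgw g"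
      using gaps_word_exists[of "[1]" c'] c c' by (auto simp: nblocks_def)
    have cgs: "c = onepat gs" using gs c' by (simp add: onepat_eq)
    have "\<exists>f. forest_word f = g" if "g \<in> set gs" for g
    proof (rule less.hyps)
      have "length g \<le> length (gaps_word 1 gs)"
        using member_le_sum_list[of "length g" "map length gs"] that
        by (simp add: length_gaps_word)
      thus "length g < length w" using w c' gs(1) by simp
      show "noncrossing g"
        using c(2) contains_onepat_mem[OF gs(2) that] cgs noncrossing_contained by blast
    qed (use gs that in blast)
    then obtain F where "\<forall>g\<in>set gs. forest_word (F g) = g" by metis
    hence "map forest_word (map F gs) = gs" by (simp add: map_idI)
    hence "tree_word (Node (map F gs)) = c" using cgs by (simp add: tree_word_Node del: map_map)
    hence "forest_word (Node (map F gs) # ts) = w"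
      using ts v' w by (simp add: forest_word_def)
    thus ?thesis by blast
  qed
qed

section \<open>Pattern containment in trees and forests\<close>

lemma contains_forest_word_connected:
  assumes "rgw p" "connected p"
  shows "contains (forest_word ts) p \<longleftrightarrow> (\<exists>t\<in>set ts. contains (tree_word t) p)"
  using contains_cat_shifted_connected[OF assms, of "map tree_word ts"]
  by (simp add: forest_word_def)

text \<open>Connectedness turns avoidance of \<open>p\<close> into a condition on each tree
  separately; surjectivity is \<open>forest_word_exists\<close>.\<close>

lemma bij_forest_word:
  assumes "rgw p" "connected p"
  shows "bij_betw forest_word (lists {t. \<not> contains (tree_word t) p}) (av_nc p)"
  unfolding bij_betw_def
proof
  show "inj_on forest_word (lists {t. \<not> contains (tree_word t) p})"
    using inj_forest_word by (rule inj_on_subset) simp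
  show "forest_word ` lists {t. \<not> contains (tree_word t) p} = av_nc p"
  proof (intro equalityI subsetI)
    fix w assume "w \<in> av_nc p"
    then obtain ts where "forest_word ts = w" "\<not> contains w p"
      using forest_word_exists by (auto simp: av_nc_def)
    thus "w \<in> forest_word ` lists {t. \<not> contains (tree_word t) p}"
      using contains_forest_word_connected[OF assms, of ts] by force
  qed (auto simp: av_nc_def noncrossing_forest_word contains_forest_word_connected[OF assms])
qed

text \<open>Counterpart of \<open>gaps_contain\<close> for gaps given as forests: by
  \<open>concat\<close>, consecutive gaps merge into one forest.\<close>

definition forests_contain :: "nat list \<Rightarrow> tree list list \<Rightarrow> bool" where
  "forests_contain s gs \<longleftrightarrow> gs \<noteq> [] \<and> contains (forest_word (concat gs)) s"

lemma chain_map: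
  "chain P Q (map f xs) \<longleftrightarrow> chain (\<lambda>as. P (map f as)) (\<lambda>bs. Q (map f bs)) xs"
proof
  assume "chain P Q (map f xs)"
  then obtain as bs where "map f xs = as @ bs" "P as" "Q bs" unfolding chain_def by blast
  then obtain us vs where "xs = us @ vs" "P (map f us)" "Q (map f vs)"
    by (auto simp: map_eq_append_conv)
  thus "chain (\<lambda>as. P (map f as)) (\<lambda>bs. Q (map f bs)) xs" unfolding chain_def by blast
next
  assume "chain (\<lambda>as. P (map f as)) (\<lambda>bs. Q (map f bs)) xs"
  thus "chain P Q (map f xs)" unfolding chain_def by (metis map_append)
qed

lemma splits_map: "splits P ss (map f xs) \<longleftrightarrow> splits (\<lambda>s xs. P s (map f xs)) ss xs"
  by (induction ss arbitrary: xs) (simp_all add: chain_map)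

lemma contains_tree_word_Node:
  assumes "\<forall>s\<in>set ss. rgw s"
  shows "contains (tree_word (Node gs)) (onepat ss) \<longleftrightarrow>
    (\<exists>g\<in>set gs. \<exists>t\<in>set g. contains (tree_word t) (onepat ss)) \<or> splits forests_contain ss gs"
proof -
  have "cat_shifted (map forest_word gs) = forest_word (concat gs)" for gs
    using cat_shifted_concat[of "map (map tree_word) gs"]
    by (simp add: forest_word_def[abs_def] map_concat comp_def)
  hence "(\<lambda>s gs. gaps_contain s (map forest_word gs)) = forests_contain"
    by (auto simp: gaps_contain_def forests_contain_def fun_eq_iff)
  thus ?thesis
    using contains_onepat_iff[OF assms, of "map forest_word gs"]
      contains_forest_word_connected[OF rgw_onepat connected_onepat, OF assms assms]
    by (simp add: tree_word_Node splits_map)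
qed

section \<open>Rearranging lists\<close>

text \<open>Keeping the multiset of each list keeps the size of the tree with these gaps as well as
  the set of its subtrees.\<close>

definition rearrangeable :: "('a list \<Rightarrow> bool) \<Rightarrow> ('a list \<Rightarrow> bool) \<Rightarrow> bool" where
  "rearrangeable Q Q' \<longleftrightarrow>
    (\<exists>\<Phi>. bij \<Phi> \<and> (\<forall>xs. mset (\<Phi> xs) = mset xs \<and> (Q' (\<Phi> xs) \<longleftrightarrow> Q xs)))"

text \<open>The intended instance is containment of a fixed pattern in a list of gaps. Pieces of a
  cut may then be enlarged freely, so only shortest ones matter.\<close>

definition ext_closed :: "('a list \<Rightarrow> bool) \<Rightarrow> bool" where
  "ext_closed P \<longleftrightarrow> (\<forall>as xs bs. P xs \<longrightarrow> P (as @ xs @ bs))"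

lemma ext_closedD:
  assumes "ext_closed P" "P xs"
  shows "P (as @ xs)" "P (xs @ bs)" "P (as @ xs @ bs)"
  using assms unfolding ext_closed_def by (metis append_Nil append_Nil2)+

lemma ext_closed_chain:
  assumes "ext_closed P" "ext_closed Q"
  shows "ext_closed (chain P Q)"
  unfolding ext_closed_def
proof (intro allI impI)
  fix as xs bs assume "chain P Q xs"
  then obtain u v where "xs = u @ v" "P u" "Q v" by (auto simp: chain_def)
  hence "as @ xs @ bs = (as @ u) @ (v @ bs)" "P (as @ u)" "Q (v @ bs)"
    using assms by (auto dest: ext_closedD)
  thus "chain P Q (as @ xs @ bs)" unfolding chain_def by blast
qed

lemma ext_closed_splits: "\<forall>s\<in>set ss. ext_closed (P s) \<Longrightarrow> ext_closed (splits P ss)"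
  by (induction ss) (auto simp: ext_closed_chain, simp add: ext_closed_def)

lemma chain_assoc: "chain (chain P Q) R = chain P (chain Q R)"
  unfolding chain_def fun_eq_iff by (metis append_assoc)

text \<open>Surjectivity is automatic: on the finite set of rearrangements of one list, an injective
  self-map is onto.\<close>

lemma rearrangeableI:
  assumes "inj \<Phi>" "\<And>xs. mset (\<Phi> xs) = mset xs" "\<And>xs. Q' (\<Phi> xs) \<longleftrightarrow> Q xs"
  shows "rearrangeable Q Q'"
proof -
  have "ys \<in> range \<Phi>" for ys
  proof -
    let ?A = "{xs. mset xs = mset ys}"
    have "?A \<subseteq> {xs. set xs \<subseteq> set ys \<and> length xs = length ys}"
      by (auto dest: mset_eq_setD mset_eq_length)
    hence "finite ?A" by (rule finite_subset) (simp add: finite_lists_length_eq)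
    moreover have "inj_on \<Phi> ?A" using assms(1) by (rule inj_on_subset) simp
    ultimately have "\<Phi> ` ?A = ?A" using assms(2) by (intro endo_inj_surj) auto
    thus ?thesis by blast
  qed
  hence "bij \<Phi>" using assms(1) by (auto simp: bij_def)
  thus ?thesis using assms unfolding rearrangeable_def by blast
qed

lemma rearrangeable_sym:
  assumes "rearrangeable Q Q'"
  shows "rearrangeable Q' Q"
proof -
  obtain \<Phi> where \<Phi>: "bij \<Phi>" "\<And>xs. mset (\<Phi> xs) = mset xs" "\<And>xs. Q' (\<Phi> xs) \<longleftrightarrow> Q xs"
    using assms unfolding rearrangeable_def by blast
  show ?thesis
  proof (rule rearrangeableI[of "inv \<Phi>"])
    show "inj (inv \<Phi>)" using \<Phi>(1) by (simp add: bij_imp_bij_inv bij_is_inj)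
    fix xs
    have "\<Phi> (inv \<Phi> xs) = xs" using \<Phi>(1) by (simp add: bij_is_surj surj_f_inv_f)
    thus "mset (inv \<Phi> xs) = mset xs" "Q (inv \<Phi> xs) \<longleftrightarrow> Q' xs"
      using \<Phi>(2,3)[of "inv \<Phi> xs"] by auto
  qed
qed

lemma rearrangeable_rev:
  assumes "rearrangeable Q Q'"
  shows "rearrangeable (\<lambda>xs. Q (rev xs)) (\<lambda>xs. Q' (rev xs))"
proof -
  obtain \<Phi> where \<Phi>: "bij \<Phi>" "\<And>xs. mset (\<Phi> xs) = mset xs" "\<And>xs. Q' (\<Phi> xs) \<longleftrightarrow> Q xs"
    using assms unfolding rearrangeable_def by blast
  show ?thesis
    by (rule rearrangeableI[of "\<lambda>xs. rev (\<Phi> (rev xs))"])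
      (use \<Phi> in \<open>auto intro!: injI dest: bij_is_inj[THEN injD]\<close>)
qed

lemma minimal_prefix_exists:
  assumes "P xs"
  shows "\<exists>as bs. xs = as @ bs \<and> P as \<and> (\<forall>cs. P cs \<longrightarrow> \<not> strict_prefix cs as)"
proof -
  define n where "n = (LEAST n. P (take n xs))"
  have "P (take (length xs) xs)" using assms by simp
  hence "P (take n xs)" unfolding n_def by (rule LeastI)
  moreover have "\<not> strict_prefix cs (take n xs)" if cs: "P cs" for cs
  proof
    assume "strict_prefix cs (take n xs)"
    then obtain ds where ds: "take n xs = cs @ ds" "ds \<noteq> []"
      by (auto elim: strict_prefixE')
    hence "length cs + length ds \<le> n" by (metis length_append length_take min.cobounded2)
    hence less: "length cs < n" using ds(2) by (cases ds) auto
    have "cs = take (length cs) (take n xs)" using ds by simp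
    hence "cs = take (length cs) xs" using less by simp
    thus False using not_less_Least[of "length cs" "\<lambda>n. P (take n xs)"] less cs n_def by metis
  qed
  ultimately show ?thesis
    by (intro exI[of _ "take n xs"] exI[of _ "drop n xs"]) auto
qed

text \<open>The shortest prefix with \<open>P\<close> stays in place and the given bijection acts on
  the rest; lists without \<open>P\<close> are fixed.\<close>

lemma rearrangeable_chain_left:
  assumes "rearrangeable Q Q'" and P: "ext_closed P" and Q: "ext_closed Q" "ext_closed Q'"
  shows "rearrangeable (chain P Q) (chain P Q')"
proof -
  define min where "min as \<longleftrightarrow> P as \<and> (\<forall>cs. P cs \<longrightarrow> \<not> strict_prefix cs as)" for as
  \<comment> \<open>Two prefixes of one list are comparable, so minimality makes them equal. The
    decomposition can thus be read off from the image.\<close>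
  have min_unique: "as = cs \<and> bs = ds" if "as @ bs = cs @ ds" "min as" "min cs" for as bs cs ds
  proof -
    have "prefix as cs \<or> prefix cs as"
      using that(1) by (metis prefixI prefix_same_cases)
    hence "as = cs" using that unfolding min_def strict_prefix_def by metis
    thus ?thesis using that(1) by simp
  qed
  \<comment> \<open>A prefix with \<open>P\<close> is at least as long as the minimal one, so the
    piece with \<open>R\<close> lies inside \<open>bs\<close>.\<close>
  have chain_min: "chain P R (as @ bs) \<longleftrightarrow> R bs" if "min as" "ext_closed R" for R as bs
  proof
    assume "chain P R (as @ bs)"
    then obtain cs ds where cd: "as @ bs = cs @ ds" "P cs" "R ds" by (auto simp: chain_def)
    then consider us where "as = cs @ us" "ds = us @ bs" | us where "cs = as @ us" "bs = us @ ds"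
      by (auto simp: append_eq_append_conv2)
    thus "R bs"
    proof cases
      case 1
      hence "us = []" using that(1) cd(2) by (auto simp: min_def strict_prefix_def)
      thus ?thesis using 1 cd by simp
    next
      case 2
      thus ?thesis using cd(3) that(2) by (auto dest: ext_closedD)
    qed
  qed (use that in \<open>auto simp: chain_def min_def\<close>)
  obtain \<Phi> where \<Phi>: "bij \<Phi>" "\<And>xs. mset (\<Phi> xs) = mset xs" "\<And>xs. Q' (\<Phi> xs) \<longleftrightarrow> Q xs"
    using assms(1) unfolding rearrangeable_def by blast
  have "\<exists>ys. (\<not> P xs \<longrightarrow> ys = xs) \<and>
      (P xs \<longrightarrow> (\<exists>as bs. xs = as @ bs \<and> min as \<and> ys = as @ \<Phi> bs))" for xs
    using minimal_prefix_exists[of P xs] unfolding min_def by blast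
  then obtain \<Psi> where \<Psi>1: "\<And>xs. \<not> P xs \<Longrightarrow> \<Psi> xs = xs"
    and \<Psi>2: "\<And>xs. P xs \<Longrightarrow> \<exists>as bs. xs = as @ bs \<and> min as \<and> \<Psi> xs = as @ \<Phi> bs"
    by metis
  \<comment> \<open>The image reveals by \<open>P\<close> which of the two cases defined it.\<close>
  have P\<Psi>: "P (\<Psi> xs) \<longleftrightarrow> P xs" for xs
    using \<Psi>1[of xs] \<Psi>2[of xs] P by (cases "P xs") (auto simp: min_def dest: ext_closedD)
  show ?thesis
  proof (rule rearrangeableI[of \<Psi>])
    show "inj \<Psi>"
    proof (rule injI)
      fix xs ys assume eq: "\<Psi> xs = \<Psi> ys"
      show "xs = ys"
      proof (cases "P xs")
        case True
        hence "P ys" using P\<Psi> eq by metis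
        from \<Psi>2[OF True] \<Psi>2[OF this] eq min_unique \<Phi>(1) show ?thesis
          by (metis bij_is_inj injD)
      next
        case False
        hence "\<not> P ys" using P\<Psi> eq by metis
        thus ?thesis using False \<Psi>1 eq by metis
      qed
    qed
    fix xs
    show "mset (\<Psi> xs) = mset xs"
      using \<Psi>1[of xs] \<Psi>2[of xs] \<Phi>(2) by (cases "P xs") auto
    show "chain P Q' (\<Psi> xs) \<longleftrightarrow> chain P Q xs"
    proof (cases "P xs")
      case True
      thus ?thesis using \<Psi>2[OF True] chain_min Q \<Phi>(3) by auto
    next
      case False
      hence "\<not> chain P R xs" for R using P by (auto simp: chain_def dest: ext_closedD)
      thus ?thesis using \<Psi>1[OF False] by simp
    qed
  qed
qed

lemma ext_closed_rev: "ext_closed P \<Longrightarrow> ext_closed (\<lambda>xs. P (rev xs))"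
  by (auto simp: ext_closed_def)

lemma chain_rev: "chain (\<lambda>xs. P (rev xs)) (\<lambda>xs. Q (rev xs)) (rev xs) \<longleftrightarrow> chain Q P xs"
  unfolding chain_def by (metis rev_append rev_rev_ident)

text \<open>Mirror image of \<open>rearrangeable_chain_left\<close>: reversal exchanges the two
  parts of a chain.\<close>

lemma rearrangeable_chain_right:
  assumes "rearrangeable Q Q'" "ext_closed P" "ext_closed Q" "ext_closed Q'"
  shows "rearrangeable (chain Q P) (chain Q' P)"
  using rearrangeable_rev[OF rearrangeable_chain_left[OF rearrangeable_rev[OF assms(1)]
    assms(2-4)[THEN ext_closed_rev]]]
  by (simp add: chain_rev)

text \<open>If \<open>as @ [g]\<close> is the shortest prefix of \<open>as @ g # bs\<close> with property \<open>P\<close>, then \<open>g # as\<close> is the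
  shortest suffix of \<open>bs @ g # as\<close> with property \<open>P\<close>.\<close>

lemma rearrangeable_chain_commute:
  assumes P: "ext_closed P" and Q: "ext_closed Q" and "\<not> P []"
    and rot: "\<And>as g. P (as @ [g]) \<longleftrightarrow> P (g # as)"
  shows "rearrangeable (chain P Q) (chain Q P)"
proof -
  have "\<exists>ys. (\<not> P xs \<longrightarrow> ys = xs) \<and> (P xs \<longrightarrow> (\<exists>as g bs. xs = as @ g # bs \<and> \<not> P as \<and>
      P (as @ [g]) \<and> ys = bs @ g # as))" for xs
  proof (cases "P xs")
    case True
    then obtain cs bs where cs: "xs = cs @ bs" "P cs" "\<forall>ds. P ds \<longrightarrow> \<not> strict_prefix ds cs"
      using minimal_prefix_exists[of P xs] by blast
    \<comment> \<open>The empty list lacks \<open>P\<close>, so the shortest prefix has a last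
      element, the pivot \<open>g\<close> of the exchange.\<close>
    hence "cs \<noteq> []" using assms(3) by auto
    then obtain as g where "cs = as @ [g]" by (metis append_butlast_last_id)
    thus ?thesis using cs True by (auto simp: strict_prefix_def)
  qed auto
  then obtain \<Psi> where \<Psi>1: "\<And>xs. \<not> P xs \<Longrightarrow> \<Psi> xs = xs"
    and \<Psi>2: "\<And>xs. P xs \<Longrightarrow> \<exists>as g bs. xs = as @ g # bs \<and> \<not> P as \<and> P (as @ [g]) \<and> \<Psi> xs = bs @ g # as"
    by metis
  have P\<Psi>: "P (\<Psi> xs) \<longleftrightarrow> P xs" for xs
  proof (cases "P xs")
    case True
    then obtain as g bs where "P (g # as)" "\<Psi> xs = bs @ g # as"
      using \<Psi>2[OF True] rot by blast
    thus ?thesis using True P by (auto dest: ext_closedD)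
  qed (use \<Psi>1 in auto)
  \<comment> \<open>A proper suffix of \<open>g # as\<close> is a suffix of \<open>as\<close> and
    hence lacks \<open>P\<close>. This lets \<open>unique\<close> recover the three parts from the
    image.\<close>
  have no_suffix: "us = []" if "g # as = us @ h # cs" "\<not> P as" "P (h # cs)" for g h us as cs
    using that P by (cases us) (auto dest: ext_closedD)
  have unique: "bs = ds \<and> g = h \<and> as = cs"
    if eq: "bs @ g # as = ds @ h # cs"
      and min: "\<not> P as" "P (g # as)" "\<not> P cs" "P (h # cs)"
    for as bs cs ds g h
  proof -
    consider us where "bs @ us = ds" "g # as = us @ h # cs"
      | us where "bs = ds @ us" "us @ g # as = h # cs"
      using append_eq_append_conv2[THEN iffD1, OF eq] by blast
    hence "bs = ds"
    proof cases
      case 1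
      thus ?thesis using no_suffix[OF 1(2) min(1,4)] by simp
    next
      case 2
      thus ?thesis using no_suffix[OF 2(2)[symmetric] min(3,2)] by simp
    qed
    thus ?thesis using eq by simp
  qed
  show ?thesis
  proof (rule rearrangeableI[of \<Psi>])
    show "inj \<Psi>"
    proof (rule injI)
      fix xs ys assume eq: "\<Psi> xs = \<Psi> ys"
      show "xs = ys"
      proof (cases "P xs")
        case True
        hence "P ys" using P\<Psi> eq by metis
        from \<Psi>2[OF True] \<Psi>2[OF this] eq unique rot show ?thesis by metis
      next
        case False
        hence "\<not> P ys" using P\<Psi> eq by metis
        thus ?thesis using False \<Psi>1 eq by metis
      qed
    qed
    fix xs
    show "mset (\<Psi> xs) = mset xs"
      using \<Psi>1[of xs] \<Psi>2[of xs] by (cases "P xs") auto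
    show "chain Q P (\<Psi> xs) \<longleftrightarrow> chain P Q xs"
    proof (cases "P xs")
      case True
      then obtain as g bs where *: "xs = as @ g # bs" "\<not> P as" "P (as @ [g])" "\<Psi> xs = bs @ g # as"
        using \<Psi>2 by blast
      \<comment> \<open>A prefix of \<open>xs\<close> with \<open>P\<close> includes the pivot
        \<open>g\<close>, and so does a suffix of the image with \<open>P\<close>. In both cases
        exactly \<open>bs\<close> is left for \<open>Q\<close>.\<close>
      have "chain P Q xs \<longleftrightarrow> Q bs"
      proof
        assume "chain P Q xs"
        then obtain us vs where uv: "as @ g # bs = us @ vs" "P us" "Q vs"
          by (auto simp: chain_def *)
        then consider z where "as = us @ z" | z where "us = as @ g # z" "bs = z @ vs"
          by (auto simp: append_eq_append_conv2 Cons_eq_append_conv)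
        thus "Q bs"
          by cases (use uv P Q * in \<open>auto dest: ext_closedD\<close>)
      next
        assume "Q bs"
        thus "chain P Q xs" unfolding chain_def using * by (metis append.assoc append_Cons append_Nil)
      qed
      moreover have "chain Q P (\<Psi> xs) \<longleftrightarrow> Q bs"
      proof
        assume "chain Q P (\<Psi> xs)"
        then obtain us vs where uv: "bs @ g # as = us @ vs" "Q us" "P vs"
          unfolding chain_def *(4) by blast
        then consider z where "bs = us @ z" | z where "as = z @ vs"
          by (auto simp: append_eq_append_conv2 Cons_eq_append_conv)
        thus "Q bs"
          by cases (use uv P Q * in \<open>auto dest: ext_closedD\<close>)
      next
        assume "Q bs"
        thus "chain Q P (\<Psi> xs)" unfolding chain_def using * rot by blast
      qed
      ultimately show ?thesis by simp
    next
      case False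
      hence "\<not> chain P Q xs" "\<not> chain Q P xs" using P by (auto simp: chain_def dest: ext_closedD)
      thus ?thesis using \<Psi>1[OF False] by simp
    qed
  qed
qed

text \<open>The two blocks are exchanged by \<open>rearrangeable_chain_commute\<close>. The blocks
  \<open>vs\<close> are attached on the right after reassociating, the blocks \<open>us\<close> on
  the left one at a time.\<close>

lemma rearrangeable_splits_swap:
  assumes "\<forall>s\<in>set (us @ a # b # vs). ext_closed (P s)" "\<not> P a []"
    and "\<And>as g. P a (as @ [g]) \<longleftrightarrow> P a (g # as)"
  shows "rearrangeable (splits P (us @ a # b # vs)) (splits P (us @ b # a # vs))"
  using assms(1)
proof (induction us)
  case Nil
  have "rearrangeable (chain (P a) (P b)) (chain (P b) (P a))"
    using Nil assms(2,3) by (intro rearrangeable_chain_commute) auto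
  hence "rearrangeable (chain (chain (P a) (P b)) (splits P vs)) (chain (chain (P b) (P a)) (splits P vs))"
    using Nil by (intro rearrangeable_chain_right ext_closed_chain ext_closed_splits) auto
  thus ?case by (simp add: chain_assoc)
next
  case (Cons u us)
  hence "rearrangeable (chain (P u) (splits P (us @ a # b # vs))) (chain (P u) (splits P (us @ b # a # vs)))"
    by (intro rearrangeable_chain_left ext_closed_splits) auto
  thus ?case by simp
qed

section \<open>Counting trees\<close>

definition avoiding :: "nat list \<Rightarrow> nat \<Rightarrow> tree set" where
  "avoiding p n = {t. length (tree_word t) = n \<and> \<not> contains (tree_word t) p}"

lemma finite_avoiding: "finite (avoiding p n)"
proof -
  have "finite {w. rgw w \<and> length w = n}"
  proof (rule finite_subset)
    show "{w. rgw w \<and> length w = n} \<subseteq> {w. set w \<subseteq> {1..n} \<and> length w = n}"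
      using rgw_letter_bounds by (fastforce simp: nblocks_def intro: order_trans card_length)
  qed (simp add: finite_lists_length_eq)
  moreover have "tree_word ` avoiding p n \<subseteq> {w. rgw w \<and> length w = n}"
    by (auto simp: avoiding_def)
  moreover have "inj_on tree_word (avoiding p n)"
    using inj_tree_word by (rule inj_on_subset) simp
  ultimately show ?thesis using finite_imageD finite_subset by metis
qed

lemma length_tree_word_Node_mset:
  assumes "mset gs = mset hs"
  shows "length (tree_word (Node gs)) = length (tree_word (Node hs))"
proof -
  have "sum_list (map (length \<circ> forest_word) gs) = sum_list (map (length \<circ> forest_word) hs)"
    by (metis assms mset_map sum_mset_sum_list)
  thus ?thesis using mset_eq_length[OF assms] by (simp add: length_tree_word_Node)
qed

lemma length_tree_word_child:
  assumes "g \<in> set gs" "t \<in> set g"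
  shows "length (tree_word t) < length (tree_word (Node gs))"
proof -
  have "length (tree_word t) \<le> length (forest_word g)"
    using member_le_sum_list[of _ "map (length \<circ> tree_word) g"] assms(2)
    by (simp add: length_forest_word)
  also have "\<dots> \<le> sum_list (map (length \<circ> forest_word) gs)"
    using member_le_sum_list[of _ "map (length \<circ> forest_word) gs"] assms(1) by simp
  finally show ?thesis by (simp add: length_tree_word_Node)
qed

text \<open>For each size the two sets of avoiders have equally large differences. These are matched
  with each other, and the common part is fixed.\<close>

lemma bij_avoiding_fixing_common:
  assumes "\<forall>m<n. card (avoiding p m) = card (avoiding p' m)"
  obtains h where
    "\<And>t. length (tree_word t) < n \<Longrightarrow> \<not> contains (tree_word t) p \<Longrightarrow>
      length (tree_word (h t)) = length (tree_word t) \<and> \<not> contains (tree_word (h t)) p' \<and>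
      (h t = t \<or> contains (tree_word t) p' \<and> contains (tree_word (h t)) p)"
    and "inj_on h {t. length (tree_word t) < n \<and> \<not> contains (tree_word t) p}"
proof -
  have "\<exists>k. bij_betw k (avoiding p m - avoiding p' m) (avoiding p' m - avoiding p m)"
    if "m < n" for m
  proof (rule finite_same_card_bij)
    have "card (avoiding p m - avoiding p' m) = card (avoiding p m) - card (avoiding p m \<inter> avoiding p' m)"
      "card (avoiding p' m - avoiding p m) = card (avoiding p' m) - card (avoiding p m \<inter> avoiding p' m)"
      by (simp_all add: card_Diff_subset_Int finite_avoiding Int_commute)
    thus "card (avoiding p m - avoiding p' m) = card (avoiding p' m - avoiding p m)"
      using assms that by simp
  qed (simp_all add: finite_avoiding)
  then obtain k where k: "\<And>m. m < n \<Longrightarrow>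
      bij_betw (k m) (avoiding p m - avoiding p' m) (avoiding p' m - avoiding p m)"
    by metis
  define h where
    "h t = (if contains (tree_word t) p' then k (length (tree_word t)) t else t)" for t
  have k_mem: "k (length (tree_word t)) t \<in> avoiding p' (length (tree_word t)) - avoiding p (length (tree_word t))"
    if "length (tree_word t) < n" "\<not> contains (tree_word t) p" "contains (tree_word t) p'" for t
    using bij_betwE[OF k[OF that(1)]] that by (simp add: avoiding_def)
  have h: "length (tree_word (h t)) = length (tree_word t) \<and> \<not> contains (tree_word (h t)) p' \<and>
      (\<not> contains (tree_word t) p' \<and> h t = t \<or> contains (tree_word t) p' \<and> contains (tree_word (h t)) p)"
    if "length (tree_word t) < n" "\<not> contains (tree_word t) p" for t
    using k_mem[OF that] by (auto simp: h_def avoiding_def)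
  have "inj_on h {t. length (tree_word t) < n \<and> \<not> contains (tree_word t) p}"
  proof (rule inj_onI, clarsimp)
    fix t u
    assume t: "length (tree_word t) < n" "\<not> contains (tree_word t) p"
      and u: "length (tree_word u) < n" "\<not> contains (tree_word u) p" and eq: "h t = h u"
    have len: "length (tree_word t) = length (tree_word u)" using h[OF t] h[OF u] eq by simp
    have iff: "contains (tree_word t) p' \<longleftrightarrow> contains (tree_word u) p'"
      using h[OF t] h[OF u] eq t(2) u(2) by auto
    show "t = u"
    proof (cases "contains (tree_word t) p'")
      case True
      thus ?thesis
        using iff eq len t u bij_betw_imp_inj_on[OF k[OF t(1)]]
        by (auto simp: h_def avoiding_def dest: inj_onD)
    qed (use iff eq in \<open>simp add: h_def\<close>)
  qed
  with h that show thesis by blast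
qed

text \<open>Applying \<open>h\<close> to all trees in the gaps makes them avoid \<open>p'\<close>,
  and rearranging the gaps turns failure of \<open>Q\<close> into failure of \<open>Q'\<close>;
  \<open>Q_map\<close> ensures that the first step does not affect \<open>Q\<close>. An injection
  suffices, as the reverse inequality arises by exchanging the two patterns.\<close>

lemma card_avoiding_le:
  assumes p: "\<And>gs. contains (tree_word (Node gs)) p \<longleftrightarrow>
      (\<exists>g\<in>set gs. \<exists>t\<in>set g. contains (tree_word t) p) \<or> Q gs"
    and p': "\<And>gs. contains (tree_word (Node gs)) p' \<longleftrightarrow>
      (\<exists>g\<in>set gs. \<exists>t\<in>set g. contains (tree_word t) p') \<or> Q' gs"
    and "rearrangeable Q Q'"
    and Q_map: "\<And>h gs. \<forall>t\<in>set (concat gs). h t = t \<or>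
      (contains (tree_word t) p \<or> contains (tree_word t) p') \<and>
      (contains (tree_word (h t)) p \<or> contains (tree_word (h t)) p') \<Longrightarrow>
      Q (map (map h) gs) \<longleftrightarrow> Q gs"
    and IH: "\<forall>m<n. card (avoiding p m) = card (avoiding p' m)"
  shows "card (avoiding p n) \<le> card (avoiding p' n)"
proof -
  obtain h where h: "\<And>t. length (tree_word t) < n \<Longrightarrow> \<not> contains (tree_word t) p \<Longrightarrow>
      length (tree_word (h t)) = length (tree_word t) \<and> \<not> contains (tree_word (h t)) p' \<and>
      (h t = t \<or> contains (tree_word t) p' \<and> contains (tree_word (h t)) p)"
    and inj_h: "inj_on h {t. length (tree_word t) < n \<and> \<not> contains (tree_word t) p}"
    using bij_avoiding_fixing_common[OF IH] by blast
  obtain \<Phi> where \<Phi>: "bij \<Phi>" "\<And>xs. mset (\<Phi> xs) = mset xs" "\<And>xs. Q' (\<Phi> xs) \<longleftrightarrow> Q xs"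
    using assms(3) unfolding rearrangeable_def by blast
  define \<Psi> where "\<Psi> t = (case t of Node gs \<Rightarrow> Node (\<Phi> (map (map h) gs)))" for t
  have child: "length (tree_word t) < n \<and> \<not> contains (tree_word t) p"
    if "Node gs \<in> avoiding p n" "g \<in> set gs" "t \<in> set g" for gs g t
    using that length_tree_word_child[OF that(2,3)] p by (auto simp: avoiding_def)
  have "inj_on \<Psi> (avoiding p n)"
  proof (rule inj_onI)
    fix t u assume t: "t \<in> avoiding p n" and u: "u \<in> avoiding p n" and eq: "\<Psi> t = \<Psi> u"
    obtain gs hs where gs: "t = Node gs" and hs: "u = Node hs" by (cases t, cases u)
    have "map (map h) gs = map (map h) hs"
      using eq \<Phi>(1) by (simp add: \<Psi>_def gs hs inj_eq bij_is_inj)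
    \<comment> \<open>\<open>h\<close> is injective only on smaller trees that avoid
      \<open>p\<close>; all trees in the gaps of a member of \<open>avoiding p n\<close> are of this
      kind.\<close>
    moreover have "inj_on (map h) (set gs \<union> set hs)"
    proof (rule inj_onI)
      fix a b assume ab: "a \<in> set gs \<union> set hs" "b \<in> set gs \<union> set hs" "map h a = map h b"
      have "set a \<union> set b \<subseteq> {t. length (tree_word t) < n \<and> \<not> contains (tree_word t) p}"
        using child t u gs hs ab(1,2) by blast
      thus "a = b" using map_inj_on[OF ab(3)] inj_on_subset[OF inj_h] by blast
    qed
    ultimately show "t = u" using map_inj_on gs hs by blast
  qed
  moreover have "\<Psi> ` avoiding p n \<subseteq> avoiding p' n"
  proof (rule image_subsetI)
    fix t assume t: "t \<in> avoiding p n"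
    obtain gs where gs: "t = Node gs" by (cases t)
    let ?hs = "map (map h) gs"
    note child = child[OF t[unfolded gs]]
    have "length (forest_word (map h g)) = length (forest_word g)" if "g \<in> set gs" for g
    proof -
      have "map (length \<circ> tree_word \<circ> h) g = map (length \<circ> tree_word) g"
        using h child[OF that] by auto
      thus ?thesis by (simp add: length_forest_word comp_assoc del: map_eq_conv)
    qed
    hence "map (length \<circ> forest_word) ?hs = map (length \<circ> forest_word) gs" by auto
    hence "length (tree_word (Node ?hs)) = length (tree_word (Node gs))"
      by (simp add: length_tree_word_Node del: map_map)
    hence len: "length (tree_word (\<Psi> t)) = n"
      using length_tree_word_Node_mset[OF \<Phi>(2)] t by (simp add: \<Psi>_def gs avoiding_def)
    have "\<not> Q gs" using t p by (simp add: gs avoiding_def)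
    moreover have "Q ?hs \<longleftrightarrow> Q gs"
      by (rule Q_map) (use h child in auto)
    ultimately have "\<not> Q' (\<Phi> ?hs)" using \<Phi>(3) by simp
    moreover have "set (\<Phi> ?hs) = set ?hs" using \<Phi>(2) by (rule mset_eq_setD)
    ultimately have "\<not> contains (tree_word (\<Psi> t)) p'"
      using h child p' by (auto simp: \<Psi>_def gs)
    thus "\<Psi> t \<in> avoiding p' n" using len by (simp add: avoiding_def)
  qed
  ultimately show ?thesis using card_inj_on_le finite_avoiding by blast
qed

text \<open>Avoiding trees of equal size are matched, and the matching is applied to every component
  of a partition. This preserves the size and the number of components.\<close>

lemma cc_equiv_if_card_avoiding:
  assumes p: "rgw p" "connected p" and p': "rgw p'" "connected p'"
    and "\<And>n. card (avoiding p n) = card (avoiding p' n)"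
  shows "cc_equiv p p'"
proof -
  let ?A = "\<lambda>p. {t. \<not> contains (tree_word t) p}"
  have "\<forall>n. \<exists>b. bij_betw b (avoiding p n) (avoiding p' n)"
    using assms(5) by (intro allI finite_same_card_bij finite_avoiding)
  then obtain b where b: "\<And>n. bij_betw (b n) (avoiding p n) (avoiding p' n)" by metis
  define H where "H t = b (length (tree_word t)) t" for t
  have H: "H t \<in> avoiding p' (length (tree_word t))" if "t \<in> ?A p" for t
    using bij_betwE[OF b] that by (auto simp: H_def avoiding_def)
  have "bij_betw H (?A p) (?A p')"
  proof (rule bij_betw_imageI)
    show "inj_on H (?A p)"
    proof (rule inj_onI)
      fix t u assume tu: "t \<in> ?A p" "u \<in> ?A p" "H t = H u"
      hence "length (tree_word t) = length (tree_word u)"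
        using H[OF tu(1)] H[OF tu(2)] by (simp add: avoiding_def)
      thus "t = u"
        using tu bij_betw_imp_inj_on[OF b, of "length (tree_word t)"]
        by (auto simp: H_def avoiding_def dest: inj_onD)
    qed
    show "H ` ?A p = ?A p'"
    proof (intro equalityI subsetI)
      fix u assume "u \<in> ?A p'"
      hence "u \<in> b (length (tree_word u)) ` avoiding p (length (tree_word u))"
        using bij_betw_imp_surj_on[OF b, of "length (tree_word u)"] by (simp add: avoiding_def)
      then obtain t where t: "u = b (length (tree_word u)) t" "t \<in> avoiding p (length (tree_word u))"
        by (rule imageE)
      have "H t = u" using t(2) t(1)[symmetric] by (simp add: H_def avoiding_def)
      moreover have "t \<in> ?A p" using t(2) by (simp add: avoiding_def)
      ultimately show "u \<in> H ` ?A p" by (metis imageI)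
    qed (use H in \<open>auto simp: avoiding_def\<close>)
  qed
  hence mapH: "bij_betw (map H) (lists (?A p)) (lists (?A p'))" by (rule bij_lists)
  note fw = bij_forest_word[OF p] and fw' = bij_forest_word[OF p']
  define f where "f = forest_word \<circ> (map H \<circ> inv_into (lists (?A p)) forest_word)"
  have "bij_betw f (av_nc p) (av_nc p')"
    unfolding f_def using bij_betw_inv_into[OF fw] mapH fw' by (blast intro: bij_betw_trans)
  moreover have "length (f w) = length w \<and> ncomp (f w) = ncomp w" if "w \<in> av_nc p" for w
  proof -
    define ts where "ts = inv_into (lists (?A p)) forest_word w"
    have ts: "ts \<in> lists (?A p)" "forest_word ts = w"
      using bij_betwE[OF bij_betw_inv_into[OF fw]] bij_betw_inv_into_right[OF fw] that
      by (auto simp: ts_def)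
    have "map (length \<circ> tree_word \<circ> H) ts = map (length \<circ> tree_word) ts"
      using ts(1) H by (auto simp: avoiding_def)
    hence "length (forest_word (map H ts)) = length (forest_word ts)"
      by (simp add: length_forest_word comp_assoc del: map_eq_conv)
    moreover have "f w = forest_word (map H ts)" by (simp add: f_def ts_def)
    ultimately show ?thesis using ts(2) by (auto simp: ncomp_forest_word)
  qed
  ultimately show ?thesis unfolding cc_equiv_def by blast
qed

section \<open>The exchange of two adjacent blocks\<close>

lemma contains_infix: "contains v s \<Longrightarrow> contains (u @ v @ w) s"
  by (rule contains_trans[OF contains_subseq[of v]]) auto

lemma ext_closed_forests_contain: "ext_closed (forests_contain s)"
  unfolding ext_closed_def forests_contain_def
proof (intro allI impI conjI; elim conjE)
  fix as xs bs :: "tree list list"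
  assume "contains (forest_word (concat xs)) s"
  moreover have "\<exists>r r'. forest_word (concat (as @ xs @ bs)) =
      forest_word (concat as) @ shift r (forest_word (concat xs)) @ shift r' (forest_word (concat bs))"
    by (simp add: forest_word_def cat_shifted_append) blast
  ultimately show "contains (forest_word (concat (as @ xs @ bs))) s"
    using contains_infix contains_shift_iff by metis
qed simp

text \<open>A growth word without repeated letters is \<open>1 2 ... m\<close>. The first
  occurrences of the letters of \<open>w\<close> are increasing, so only the number of blocks
  counts.\<close>

lemma contains_distinct_iff:
  assumes "rgw s" "distinct s" "rgw w"
  shows "contains w s \<longleftrightarrow> nblocks s \<le> nblocks w"
proof
  assume "contains w s"
  then obtain f where f: "strict_mono_on (set s) f" "subseq (map f s) w" by (auto simp: contains_iff)
  have "card (f ` set s) = card (set s)"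
    using f(1) by (intro card_image strict_mono_on_imp_inj_on)
  moreover have "card (f ` set s) \<le> card (set w)"
    using set_subseq[OF f(2)] by (intro card_mono) auto
  ultimately show "nblocks s \<le> nblocks w" by (simp add: nblocks_def)
next
  assume le: "nblocks s \<le> nblocks w"
  have "length [1..<Suc (nblocks s)] = length s"
    using assms(2) by (simp add: nblocks_def distinct_card del: upt_Suc)
  hence s: "s = [1..<Suc (nblocks s)]"
    using subseq_upt_rgw[OF assms(1)] subseq_same_length by metis
  have "[1..<Suc (nblocks w)] = [1..<Suc (nblocks s)] @ [Suc (nblocks s)..<Suc (nblocks w)]"
    using upt_add_eq_append[of 1 "Suc (nblocks s)" "nblocks w - nblocks s"] le by simp
  hence "subseq s [1..<Suc (nblocks w)]"
    using s by (metis prefixI prefix_imp_subseq)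
  thus "contains w s"
    using subseq_upt_rgw[OF assms(3)] subseq_order.trans contains_subseq by blast
qed

lemma nblocks_forest_word: "nblocks (forest_word ts) = sum_list (map (nblocks \<circ> tree_word) ts)"
  by (simp add: forest_word_def rgw_nblocks_cat_shifted)

text \<open>The three kinds of \<open>s\<close> are used here. For connected \<open>s\<close> one
  tree must contain it, for singleton blocks the block numbers of the trees are added up, and for
  empty \<open>s\<close> a gap must exist; none of this depends on the order of the gaps.\<close>

lemma forests_contain_rotate:
  assumes "rgw s" "s = [] \<or> connected s \<or> distinct s"
  shows "forests_contain s (as @ [g]) \<longleftrightarrow> forests_contain s (g # as)"
  using assms(2)
proof (elim disjE)
  assume "connected s"
  thus ?thesis
    using contains_forest_word_connected[OF assms(1)] by (auto simp: forests_contain_def)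
next
  assume "distinct s"
  thus ?thesis
    using contains_distinct_iff[OF assms(1)]
    by (simp add: forests_contain_def nblocks_forest_word add.commute)
qed (simp add: forests_contain_def)

lemma splits_cong:
  assumes "\<And>s xs. s \<in> set ss \<Longrightarrow> set xs \<subseteq> A \<Longrightarrow> P s xs \<longleftrightarrow> P' s xs" "set xs \<subseteq> A"
  shows "splits P ss xs \<longleftrightarrow> splits P' ss xs"
  using assms
proof (induction ss arbitrary: xs)
  case (Cons s ss)
  have "P s as \<and> splits P ss bs \<longleftrightarrow> P' s as \<and> splits P' ss bs" if "xs = as @ bs" for as bs
    using Cons that by auto
  thus ?case unfolding splits_simps chain_def by blast
qed simp

text \<open>If some tree is moved by \<open>h\<close>, both it and its image contain
  \<open>p\<close> or \<open>p'\<close> and hence \<open>s\<close>, so both sides are true.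
  Otherwise nothing changes.\<close>

lemma forests_contain_map:
  assumes "contains p s" "contains p' s"
    and "\<forall>t\<in>set (concat gs). h t = t \<or>
      (contains (tree_word t) p \<or> contains (tree_word t) p') \<and>
      (contains (tree_word (h t)) p \<or> contains (tree_word (h t)) p')"
  shows "forests_contain s (map (map h) gs) \<longleftrightarrow> forests_contain s gs"
proof (cases "\<forall>t\<in>set (concat gs). h t = t")
  case True
  hence "map (map h) gs = gs" by (intro map_idI) auto
  thus ?thesis by simp
next
  case False
  then obtain t where t: "t \<in> set (concat gs)" "contains (tree_word t) s" "contains (tree_word (h t)) s"
    using assms contains_trans by blast
  have "contains (forest_word ts) s" if "u \<in> set ts" "contains (tree_word u) s" for u ts
    using contains_cat_shifted_mem[of "tree_word u" "map tree_word ts"] that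
    by (simp add: forest_word_def)
  hence "contains (forest_word (concat gs)) s" "contains (forest_word (map h (concat gs))) s"
    using t by (metis, metis image_eqI set_map)
  thus ?thesis by (simp add: forests_contain_def map_concat)
qed

lemma splits_forests_contain_map:
  assumes "\<forall>s\<in>set ss. contains p s \<and> contains p' s"
    and "\<forall>t\<in>set (concat gs). h t = t \<or>
      (contains (tree_word t) p \<or> contains (tree_word t) p') \<and>
      (contains (tree_word (h t)) p \<or> contains (tree_word (h t)) p')"
  shows "splits forests_contain ss (map (map h) gs) \<longleftrightarrow> splits forests_contain ss gs"
  unfolding splits_map
proof (rule splits_cong[where A = "set gs"])
  fix s xs assume "s \<in> set ss" "set xs \<subseteq> set gs"
  thus "forests_contain s (map (map h) xs) \<longleftrightarrow> forests_contain s xs"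
    using assms by (intro forests_contain_map[of p s p']) auto
qed simp

text \<open>Induction on the size, with both inequalities from \<open>card_avoiding_le\<close>, the
  second by the inverse rearrangement. The two patterns contain every block of either, so replacing
  trees by \<open>h\<close> does not affect \<open>splits\<close>.\<close>

lemma cc_equiv_onepat_swap:
  assumes rgw: "\<forall>s\<in>set (us @ a # b # vs). rgw s" and a: "a = [] \<or> connected a \<or> distinct a"
  shows "cc_equiv (onepat (us @ a # b # vs)) (onepat (us @ b # a # vs))"
proof -
  let ?ss = "us @ a # b # vs" and ?ss' = "us @ b # a # vs"
  have rgw': "\<forall>s\<in>set ?ss'. rgw s" using rgw by auto
  have swap: "rearrangeable (splits forests_contain ?ss) (splits forests_contain ?ss')"
    using rgw a by (intro rearrangeable_splits_swap forests_contain_rotate)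
      (auto simp: ext_closed_forests_contain forests_contain_def)
  have ss: "\<forall>s\<in>set ?ss. contains (onepat ?ss) s \<and> contains (onepat ?ss') s"
    using contains_onepat_mem[OF rgw] contains_onepat_mem[OF rgw'] by simp
  hence ss': "\<forall>s\<in>set ?ss'. contains (onepat ?ss') s \<and> contains (onepat ?ss) s" by auto
  have "card (avoiding (onepat ?ss) n) = card (avoiding (onepat ?ss') n)" for n
  proof (induction n rule: less_induct)
    case (less n)
    show ?case
    proof (rule antisym)
      show "card (avoiding (onepat ?ss) n) \<le> card (avoiding (onepat ?ss') n)"
        using less.IH
        by (intro card_avoiding_le[OF contains_tree_word_Node[OF rgw] contains_tree_word_Node[OF rgw']
            swap splits_forests_contain_map[OF ss]]) auto
      show "card (avoiding (onepat ?ss') n) \<le> card (avoiding (onepat ?ss) n)"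
        using less.IH
        by (intro card_avoiding_le[OF contains_tree_word_Node[OF rgw'] contains_tree_word_Node[OF rgw]
            rearrangeable_sym[OF swap] splits_forests_contain_map[OF ss']]) auto
    qed
  qed
  thus ?thesis
    using rgw rgw' by (intro cc_equiv_if_card_avoiding rgw_onepat connected_onepat)
qed

theorem theorem3p5:
  fixes ss :: "nat list list" and q :: nat
  assumes "\<forall>s\<in>set ss. rgw s \<and> noncrossing s"
    and "Suc q < length ss"
    and "ss ! q = [] \<or> connected (ss ! q) \<or> distinct (ss ! q)"
  shows "cc_equiv (onepat ss) (onepat (ss[q := ss ! Suc q, Suc q := ss ! q]))"
proof -
  define us vs where "us = take q ss" and "vs = drop (Suc (Suc q)) ss"
  have ss: "ss = us @ ss ! q # ss ! Suc q # vs"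
    using assms(2) by (simp add: us_def vs_def Cons_nth_drop_Suc)
  have "length us = q" using assms(2) by (simp add: us_def)
  hence "ss[q := ss ! Suc q, Suc q := ss ! q] = us @ ss ! Suc q # ss ! q # vs"
    by (subst ss) (simp add: list_update_append)
  thus ?thesis
    using cc_equiv_onepat_swap[of us "ss ! q" "ss ! Suc q" vs] assms(1,3) ss by metis
qed

end
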